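(* Let $T_1$ and $T_2$ be trees on $n$ vertices, and let $J_1$ and $J_2$ be the cover ideals, in $S=\mathsf{k}[X_1,\dots,X_n]$, of the complement graphs of $T_1$ and $T_2$ respectively. Then $J_1^s$ and $J_2^s$ have the same Betti numbers for all $s\ge 1$; that is, $\beta^S_{i,j}(J_1^s)=\beta^S_{i,j}(J_2^s)$ for all $i,j$ and all $s\ge 1$.
   Context: $\mathsf{k}$ is a field and $S=\mathsf{k}[X_1,\dots,X_n]$ has the standard grading; graphs are finite and simple on the vertex set $[n]=\{1,\dots,n\}$. The complement graph $G^c$ of $G$ has the same vertices, and $\{i,j\}$ ($i\ne j$) is an edge of $G^c$ if and only if it is not an edge of $G$. A subset $C\subset[n]$ is a cover set of $G$ if it meets every edge of $G$; it is minimal if $C\setminus\{l\}$ is not a cover set for any $l\in C$. The cover ideal of $G$ is $J(G)=\langle\prod_{i\in C}X_i: C\text{ is a minimal cover set of }G\rangle\subset S$ (an empty product being $1$). $\beta^S_{i,j}(M)=\dim_{\mathsf{k}}\operatorname{Tor}_i^S(M,\mathsf{k})_j$ is the $(i,j)$-th graded Betti number of $M$. *)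

theory Defs
  imports Complex_Main "HOL-Library.Poly_Mapping"
begin

section \<open>Graphs\<close>

text \<open>
  A finite simple graph on the vertex set \<open>[n]\<close> is given by its set of edges, each edge being a
  two-element set of vertices. The vertices are the elements of a finite type \<open>'n\<close>, so \<open>n\<close> is the
  (arbitrary, positive) cardinality of that type.
\<close>

type_synonym 'n graph = "'n set set"

definition simple_graph :: "'n graph \<Rightarrow> bool" where
  "simple_graph G \<longleftrightarrow> (\<forall>e\<in>G. card e = 2)"

definition complement_graph :: "'n graph \<Rightarrow> 'n graph" where
  "complement_graph G = {{i, j} | i j. i \<noteq> j \<and> {i, j} \<notin> G}"

definition connected_graph :: "'n graph \<Rightarrow> bool" where
  "connected_graph G \<longleftrightarrow> (\<forall>u v. (u, v) \<in> {(x, y). {x, y} \<in> G}\<^sup>*)"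

definition cycle_in :: "'n graph \<Rightarrow> 'n list \<Rightarrow> bool" where
  "cycle_in G vs \<longleftrightarrow> 3 \<le> length vs \<and> distinct vs \<and>
     (\<forall>k<length vs. {vs ! k, vs ! (Suc k mod length vs)} \<in> G)"

definition tree_graph :: "'n graph \<Rightarrow> bool" where
  "tree_graph G \<longleftrightarrow> simple_graph G \<and> connected_graph G \<and> (\<nexists>vs. cycle_in G vs)"

definition cover_set :: "'n graph \<Rightarrow> 'n set \<Rightarrow> bool" where
  "cover_set G C \<longleftrightarrow> (\<forall>e\<in>G. C \<inter> e \<noteq> {})"

definition minimal_cover_set :: "'n graph \<Rightarrow> 'n set \<Rightarrow> bool" where
  "minimal_cover_set G C \<longleftrightarrow> cover_set G C \<and> (\<forall>l\<in>C. \<not> cover_set G (C - {l}))"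


section \<open>The polynomial ring and its ideals\<close>

text \<open>
  The ring \<open>S\<close> is the whole type \<open>('n, 'k) mpoly\<close>: a polynomial is a finitely supported map from
  monomials (exponent vectors) to coefficients. The product of HOL-Library.Poly_Mapping is the
  convolution product.
\<close>

type_synonym ('n, 'k) mpoly = "('n \<Rightarrow>\<^sub>0 nat) \<Rightarrow>\<^sub>0 'k"

definition Const :: "'k::field \<Rightarrow> ('n, 'k) mpoly" where
  "Const c = Poly_Mapping.single 0 c"

definition X :: "'n \<Rightarrow> ('n, 'k::field) mpoly" where
  "X i = Poly_Mapping.single (Poly_Mapping.single i 1) 1"

definition monom_degree :: "('n::finite \<Rightarrow>\<^sub>0 nat) \<Rightarrow> nat" where
  "monom_degree m = (\<Sum>i\<in>UNIV. Poly_Mapping.lookup m i)"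

text \<open>The graded component \<open>S\<^sub>j\<close>, which is \<open>0\<close> for negative \<open>j\<close>.\<close>

definition S_comp :: "int \<Rightarrow> ('n::finite, 'k::field) mpoly set" where
  "S_comp j = {p. \<forall>m\<in>Poly_Mapping.keys p. int (monom_degree m) = j}"

abbreviation ideal_gen :: "('n, 'k::field) mpoly set \<Rightarrow> ('n, 'k) mpoly set" where
  "ideal_gen \<equiv> module.span (*)"

definition ideal_mult ::
    "('n, 'k::field) mpoly set \<Rightarrow> ('n, 'k) mpoly set \<Rightarrow> ('n, 'k) mpoly set" where
  "ideal_mult I J = ideal_gen {a * b | a b. a \<in> I \<and> b \<in> J}"

primrec ideal_power :: "('n, 'k::field) mpoly set \<Rightarrow> nat \<Rightarrow> ('n, 'k) mpoly set" where
  "ideal_power I 0 = UNIV"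
| "ideal_power I (Suc s) = ideal_mult I (ideal_power I s)"

definition cover_ideal :: "'n::finite graph \<Rightarrow> ('n, 'k::field) mpoly set" where
  "cover_ideal G = ideal_gen {\<Prod>i\<in>C. X i | C. minimal_cover_set G C}"

definition max_ideal :: "('n, 'k::field) mpoly set" where
  "max_ideal = ideal_gen (range X)"


section \<open>Graded free modules\<close>

text \<open>
  The type \<open>('n, 'k) free\<close> is the free \<open>S\<close>-module with basis \<open>e\<^sub>0, e\<^sub>1, \<dots>\<close>. A list \<open>ds\<close> of integers
  describes the graded free module \<open>F = \<Oplus>\<^sub>b S(-ds\<^sub>b)\<close> of rank \<open>length ds\<close>, in which \<open>e\<^sub>b\<close> has degree
  \<open>ds\<^sub>b\<close>, as a direct summand of it.
\<close>

type_synonym ('n, 'k) free = "nat \<Rightarrow>\<^sub>0 ('n, 'k) mpoly"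

definition fscale :: "('n, 'k::field) mpoly \<Rightarrow> ('n, 'k) free \<Rightarrow> ('n, 'k) free" where
  "fscale p v = Poly_Mapping.map ((*) p) v"

definition kscale :: "'k::field \<Rightarrow> ('n, 'k) free \<Rightarrow> ('n, 'k) free" where
  "kscale c = fscale (Const c)"

definition F_carrier :: "int list \<Rightarrow> ('n, 'k::field) free set" where
  "F_carrier ds = {v. Poly_Mapping.keys v \<subseteq> {..<length ds}}"

definition F_comp :: "int list \<Rightarrow> int \<Rightarrow> ('n::finite, 'k::field) free set" where
  "F_comp ds j = {v \<in> F_carrier ds. \<forall>b<length ds. Poly_Mapping.lookup v b \<in> S_comp (j - ds ! b)}"

text \<open>The submodule \<open>\<mm>F\<close> for the ideal \<open>\<mm>\<close> generated by the variables.\<close>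

definition mF :: "int list \<Rightarrow> ('n, 'k::field) free set" where
  "mF ds = module.span fscale {fscale p v | p v. p \<in> max_ideal \<and> v \<in> F_carrier ds}"

lemma module_mpoly: "module ((*) :: ('n, 'k::field) mpoly \<Rightarrow> _)"
  by unfold_locales (simp_all add: algebra_simps)

lemma lookup_fscale: "Poly_Mapping.lookup (fscale p v) b = p * Poly_Mapping.lookup v b"
  unfolding fscale_def by transfer (simp add: when_def)

lemma module_fscale: "module (fscale :: ('n, 'k::field) mpoly \<Rightarrow> _)"
  by unfold_locales
    (auto intro!: poly_mapping_eqI simp: lookup_fscale lookup_add algebra_simps)

lemma vector_space_kscale: "vector_space (kscale :: 'k::field \<Rightarrow> ('n, 'k) free \<Rightarrow> _)"
proof -
  have "Const (a + b) = (Const a + Const b :: ('n, 'k) mpoly)"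
    and "Const (a * b) = (Const a * Const b :: ('n, 'k) mpoly)"
    and "Const 1 = (1 :: ('n, 'k) mpoly)" for a b :: 'k
    by (simp_all add: Const_def single_add mult_single)
  then show ?thesis
    by unfold_locales
      (auto intro!: poly_mapping_eqI simp: kscale_def lookup_fscale lookup_add algebra_simps)
qed


section \<open>Graded Betti numbers\<close>

text \<open>
  A graded free resolution
  \<open>\<dots> \<rightarrow> F\<^sub>2 \<rightarrow> F\<^sub>1 \<rightarrow> F\<^sub>0 \<rightarrow> M \<rightarrow> 0\<close> of a homogeneous ideal \<open>M\<close> of \<open>S\<close> by free modules of finite rank:
  \<open>F\<^sub>i\<close> is the graded free module given by \<open>ds i\<close>, the map \<open>F\<^sub>0 \<rightarrow> M\<close> is \<open>aug\<close>, and
  \<open>\<delta> i\<close> is the map \<open>F\<^bsub>i+1\<^esub> \<rightarrow> F\<^sub>i\<close>. All maps are \<open>S\<close>-linear of degree 0. Since \<open>F\<^sub>i\<close> is a direct summand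
  of the type \<open>('n, 'k) free\<close>, it is no restriction that they are defined on the whole type.
\<close>

definition graded_free_resolution ::
    "('n::finite, 'k::field) mpoly set \<Rightarrow> (nat \<Rightarrow> int list) \<Rightarrow>
     (('n, 'k) free \<Rightarrow> ('n, 'k) mpoly) \<Rightarrow> (nat \<Rightarrow> ('n, 'k) free \<Rightarrow> ('n, 'k) free) \<Rightarrow> bool" where
  "graded_free_resolution M ds aug \<delta> \<longleftrightarrow>
     module_hom fscale (*) aug \<and>
     (\<forall>j. aug ` F_comp (ds 0) j \<subseteq> S_comp j) \<and>
     (\<forall>i. module_hom fscale fscale (\<delta> i)) \<and>
     (\<forall>i j. \<delta> i ` F_comp (ds (Suc i)) j \<subseteq> F_comp (ds i) j) \<and>
     aug ` F_carrier (ds 0) = M \<and>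
     {v \<in> F_carrier (ds 0). aug v = 0} = \<delta> 0 ` F_carrier (ds 1) \<and>
     (\<forall>i. {v \<in> F_carrier (ds (Suc i)). \<delta> i v = 0} = \<delta> (Suc i) ` F_carrier (ds (Suc (Suc i))))"

text \<open>
  With \<open>\<kk> = S/\<mm>\<close>, the complex \<open>F \<otimes>\<^sub>S \<kk>\<close> is \<open>F/\<mm>F\<close>. Its homology at \<open>F\<^sub>i/\<mm>F\<^sub>i\<close> in degree \<open>j\<close> is the
  quotient of \<open>tor_cycles\<close> by \<open>tor_boundaries\<close>, the preimages in the degree \<open>j\<close> part of \<open>F\<^sub>i\<close> of
  the cycles and of the boundaries. These are finite-dimensional, because \<open>F\<^sub>i\<close> has finite rank, so
  the dimension of the quotient is the difference of the dimensions.
\<close>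

definition tor_cycles ::
    "(nat \<Rightarrow> int list) \<Rightarrow> (nat \<Rightarrow> ('n::finite, 'k::field) free \<Rightarrow> ('n, 'k) free) \<Rightarrow>
     nat \<Rightarrow> int \<Rightarrow> ('n, 'k) free set" where
  "tor_cycles ds \<delta> i j =
     {v \<in> F_comp (ds i) j. case i of 0 \<Rightarrow> True | Suc i' \<Rightarrow> \<delta> i' v \<in> mF (ds i')}"

definition tor_boundaries ::
    "(nat \<Rightarrow> int list) \<Rightarrow> (nat \<Rightarrow> ('n::finite, 'k::field) free \<Rightarrow> ('n, 'k) free) \<Rightarrow>
     nat \<Rightarrow> int \<Rightarrow> ('n, 'k) free set" where
  "tor_boundaries ds \<delta> i j =
     {\<delta> i w + u | w u. w \<in> F_comp (ds (Suc i)) j \<and> u \<in> mF (ds i) \<inter> F_comp (ds i) j}"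

definition tor_dim ::
    "(nat \<Rightarrow> int list) \<Rightarrow> (nat \<Rightarrow> ('n::finite, 'k::field) free \<Rightarrow> ('n, 'k) free) \<Rightarrow>
     nat \<Rightarrow> int \<Rightarrow> nat" where
  "tor_dim ds \<delta> i j =
     vector_space.dim kscale (tor_cycles ds \<delta> i j) -
     vector_space.dim kscale (tor_boundaries ds \<delta> i j)"

text \<open>
  \<open>betti M i j\<close> is the dimension over \<open>\<kk>\<close> of the degree \<open>j\<close> part of \<open>Tor\<^sub>i(M, \<kk>)\<close>, for a homogeneous
  ideal \<open>M\<close>; it does not depend on the resolution used to compute it.
\<close>

definition betti :: "('n::finite, 'k::field) mpoly set \<Rightarrow> nat \<Rightarrow> int \<Rightarrow> nat" where
  "betti M i j =
     (THE d. \<exists>ds aug \<delta>. graded_free_resolution M ds aug \<delta> \<and> d = tor_dim ds \<delta> i j)"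

end

theory Submission
  imports Defs
begin

text \<open>
  Let \<open>T\<close> be a tree with \<open>n \<ge> 2\<close> vertices. A minimal cover set of its complement graph is the
  complement of a maximal clique of \<open>T\<close>, and as \<open>T\<close> has no triangles, the maximal cliques are the
  edges. Hence the cover ideal is generated by the monomials \<open>X\<^bsub>[n] - e\<^esub>\<close> with \<open>e \<in> T\<close>. The claim
  becomes: the \<open>s\<close>-th power of this ideal has a linear resolution, whose ranks depend on \<open>n\<close> and \<open>s\<close>
  only. Two homogeneous ideals with linear resolutions of the same shape have the same Betti numbers.

  The resolution is built by removing a leaf. Let \<open>v\<close> be a leaf attached to the vertex \<open>u\<close> of a tree
  on the vertex set \<open>V\<close>, let \<open>J'\<close> be the ideal of the tree on \<open>V\<close>, and let \<open>J\<close> be the ideal of the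
  larger tree. The new edge contributes the generator \<open>h = X\<^bsub>V - {u}\<^esub>\<close>, and all the other generators
  are those of \<open>J'\<close>, multiplied by \<open>X\<^sub>v\<close>. Since \<open>u\<close> lies on some edge \<open>e\<close> of the smaller tree, the
  monomial \<open>h\<close> is a multiple of \<open>X\<^bsub>V - e\<^esub>\<close>, that is, \<open>h \<in> J'\<close>. A product of \<open>s + 1\<close> generators
  of \<open>J\<close> either contains \<open>h\<close>, or all its factors are divisible by \<open>X\<^sub>v\<close>, which gives
  \<open>J\<^bsup>s+1\<^esup> = X\<^sub>v\<^bsup>s+1\<^esup> J'\<^bsup>s+1\<^esup> + h J\<^bsup>s\<^esup>\<close> (\<open>power_exps_leaf\<close>). Because of \<open>h \<in> J'\<close>, the two summands
  intersect in \<open>X\<^sub>v\<^bsup>s+1\<^esup> h J'\<^bsup>s\<^esup>\<close> (\<open>power_exps_leaf_Int\<close>).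
  By induction the ideals \<open>J'\<^bsup>s+1\<^esup>\<close>, \<open>J\<^bsup>s\<^esup>\<close> and \<open>J'\<^bsup>s\<^esup>\<close> have linear
  resolutions; the summands are generated in the same degree, and their intersection is generated in the
  next degree. In this situation the mapping cone of the intersection into the two summands is a linear
  resolution of the sum (\<open>linear_resolution_sum\<close>), and its ranks follow from those of the three ideals.

  Betti numbers may be computed from any graded free resolution (\<open>betti_eq_tor_dim\<close>), because two
  resolutions of the same ideal are homotopy equivalent: both the chain maps and the homotopy are
  constructed degree by degree, lifting the images of basis elements to homogeneous preimages
  (\<open>graded_lift\<close>). In a linear resolution all maps become zero modulo the maximal ideal for degree
  reasons, so the dimensions of Tor are determined by the ranks (\<open>tor_dim_linear\<close>).
\<close>

interpretation mpoly: module "(*) :: ('n, 'k::field) mpoly \<Rightarrow> _"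
  by (rule module_mpoly)

interpretation free: module "fscale :: ('n, 'k::field) mpoly \<Rightarrow> _"
  by (rule module_fscale)

interpretation kfree: vector_space "kscale :: 'k::field \<Rightarrow> ('n, 'k) free \<Rightarrow> _"
  by (rule vector_space_kscale)

abbreviation lookup where "lookup \<equiv> Poly_Mapping.lookup"
abbreviation keys where "keys \<equiv> Poly_Mapping.keys"
abbreviation single where "single \<equiv> Poly_Mapping.single"

section \<open>Homogeneous components\<close>

lemma mpoly_expansion: "p = (\<Sum>m\<in>keys p. single m (lookup p m))"
  by (rule poly_mapping_eqI) (simp add: lookup_sum lookup_single when_def in_keys_iff)

lemma monom_degree_add: "monom_degree (a + b) = monom_degree a + monom_degree b"
  by (simp add: monom_degree_def lookup_add sum.distrib)

lemma monom_degree_0 [simp]: "monom_degree 0 = 0"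
  by (simp add: monom_degree_def)

lemma S_compD: "p \<in> S_comp j \<Longrightarrow> lookup p m \<noteq> 0 \<Longrightarrow> int (monom_degree m) = j"
  by (auto simp: S_comp_def in_keys_iff)

lemma S_compI: "(\<And>m. lookup p m \<noteq> 0 \<Longrightarrow> int (monom_degree m) = j) \<Longrightarrow> p \<in> S_comp j"
  by (auto simp: S_comp_def in_keys_iff)

lemma S_comp_0 [simp]: "0 \<in> S_comp j"
  by (simp add: S_comp_def)

lemma S_comp_add: "p \<in> S_comp j \<Longrightarrow> q \<in> S_comp j \<Longrightarrow> p + q \<in> S_comp j"
  by (rule S_compI) (metis S_compD add.right_neutral lookup_add)

lemma S_comp_uminus: "p \<in> S_comp j \<Longrightarrow> - p \<in> S_comp j"
  by (rule S_compI) (simp add: S_compD)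

lemma S_comp_mult: "p \<in> S_comp i \<Longrightarrow> q \<in> S_comp j \<Longrightarrow> p * q \<in> S_comp (i + j)"
  using keys_mult[of p q] by (fastforce simp: S_comp_def monom_degree_add)

lemma S_comp_single: "int (monom_degree m) = j \<Longrightarrow> single m c \<in> S_comp j"
  by (auto simp: S_comp_def)

lemma S_comp_1: "1 \<in> S_comp 0"
  using S_comp_single[of 0 0 1] by (simp add: single_one)

definition hom_part :: "int \<Rightarrow> ('n::finite, 'k::field) mpoly \<Rightarrow> ('n, 'k) mpoly" where
  "hom_part j p = (\<Sum>m\<in>{m \<in> keys p. int (monom_degree m) = j}. single m (lookup p m))"

lemma lookup_hom_part:
  "lookup (hom_part j p) m = (if int (monom_degree m) = j then lookup p m else 0)"
  by (auto simp: hom_part_def lookup_sum lookup_single when_def in_keys_iff)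

lemma hom_part_0 [simp]: "hom_part j 0 = 0"
  by (simp add: poly_mapping_eq_iff fun_eq_iff lookup_hom_part)

lemma hom_part_add: "hom_part j (p + q) = hom_part j p + hom_part j q"
  by (simp add: poly_mapping_eq_iff fun_eq_iff lookup_hom_part lookup_add)

lemma hom_part_in_S_comp: "hom_part j p \<in> S_comp j"
  by (rule S_compI) (simp add: lookup_hom_part split: if_splits)

lemma hom_part_S_comp: "p \<in> S_comp i \<Longrightarrow> hom_part j p = (if i = j then p else 0)"
  by (auto simp: poly_mapping_eq_iff fun_eq_iff lookup_hom_part dest: S_compD)

lemma F_carrierD: "v \<in> F_carrier ds \<Longrightarrow> length ds \<le> b \<Longrightarrow> lookup v b = 0"
  by (force simp: F_carrier_def in_keys_iff)

lemma F_carrierI: "(\<And>b. length ds \<le> b \<Longrightarrow> lookup v b = 0) \<Longrightarrow> v \<in> F_carrier ds"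
  by (force simp: F_carrier_def in_keys_iff not_le[symmetric])

lemma subspace_F_carrier: "free.subspace (F_carrier ds)"
  by (rule free.subspaceI) (auto intro!: F_carrierI simp: lookup_add lookup_fscale F_carrierD)

lemma F_compD: "v \<in> F_comp ds j \<Longrightarrow> b < length ds \<Longrightarrow> lookup v b \<in> S_comp (j - ds ! b)"
  by (simp add: F_comp_def)

lemma F_comp_carrier: "v \<in> F_comp ds j \<Longrightarrow> v \<in> F_carrier ds"
  by (simp add: F_comp_def)

lemma F_comp_0 [simp]: "0 \<in> F_comp ds j"
  by (simp add: F_comp_def F_carrier_def)

lemma F_comp_add: "v \<in> F_comp ds j \<Longrightarrow> w \<in> F_comp ds j \<Longrightarrow> v + w \<in> F_comp ds j"
  by (auto simp: F_comp_def lookup_add intro: S_comp_add free.subspace_add[OF subspace_F_carrier])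

lemma F_comp_fscale: "p \<in> S_comp i \<Longrightarrow> v \<in> F_comp ds j \<Longrightarrow> fscale p v \<in> F_comp ds (i + j)"
  using S_comp_mult[of p i]
  by (fastforce simp: F_comp_def lookup_fscale algebra_simps
      intro: free.subspace_scale[OF subspace_F_carrier])

lemma F_comp_kscale: "v \<in> F_comp ds j \<Longrightarrow> kscale c v \<in> F_comp ds j"
  using F_comp_fscale[of "Const c" 0 v ds j] by (simp add: kscale_def Const_def S_comp_single)

lemma F_comp_uminus: "v \<in> F_comp ds j \<Longrightarrow> - v \<in> F_comp ds j"
  by (auto simp: F_comp_def intro: S_comp_uminus free.subspace_neg[OF subspace_F_carrier])

lemma F_comp_diff: "v \<in> F_comp ds j \<Longrightarrow> w \<in> F_comp ds j \<Longrightarrow> v - w \<in> F_comp ds j"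
  using F_comp_add[of v ds j "- w"] F_comp_uminus by auto

lemma F_comp_sum: "(\<And>x. x \<in> A \<Longrightarrow> f x \<in> F_comp ds j) \<Longrightarrow> sum f A \<in> F_comp ds j"
  by (induct A rule: infinite_finite_induct) (auto intro: F_comp_add)

lemma subspace_F_comp: "kfree.subspace (F_comp ds j)"
  by (rule kfree.subspaceI) (auto intro: F_comp_add F_comp_kscale)

definition F_part :: "int list \<Rightarrow> int \<Rightarrow> ('n::finite, 'k::field) free \<Rightarrow> ('n, 'k) free" where
  "F_part ds j v = (\<Sum>b<length ds. single b (hom_part (j - ds ! b) (lookup v b)))"

lemma lookup_F_part:
  "lookup (F_part ds j v) b = (if b < length ds then hom_part (j - ds ! b) (lookup v b) else 0)"
  by (simp add: F_part_def lookup_sum lookup_single when_def)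

lemma F_part_in_F_comp: "F_part ds j v \<in> F_comp ds j"
  by (auto simp: F_comp_def lookup_F_part hom_part_in_S_comp intro!: F_carrierI)

lemma F_part_add: "F_part ds j (v + w) = F_part ds j v + F_part ds j w"
  by (simp add: poly_mapping_eq_iff[where 'a=nat] fun_eq_iff lookup_F_part lookup_add hom_part_add)

lemma F_part_0 [simp]: "F_part ds j 0 = 0"
  by (simp add: poly_mapping_eq_iff[where 'a=nat] fun_eq_iff lookup_F_part)

lemma F_part_sum: "F_part ds j (sum f A) = (\<Sum>x\<in>A. F_part ds j (f x))"
  by (induct A rule: infinite_finite_induct) (auto simp: F_part_add)

lemma F_part_F_comp: "v \<in> F_comp ds i \<Longrightarrow> F_part ds j v = (if i = j then v else 0)"
  by (auto simp: poly_mapping_eq_iff[where 'a=nat] fun_eq_iff lookup_F_part hom_part_S_comp[OF F_compD]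
      F_carrierD[OF F_comp_carrier])

text \<open>
  Homomorphisms respect finite sums only, so a vector is written as the sum of its homogeneous parts over
  a finite set of degrees, outside of which the parts vanish.
\<close>

lemma F_decompose:
  assumes "v \<in> F_carrier ds"
  obtains I where "finite I" and "v = (\<Sum>j\<in>I. F_part ds j v)" and "\<And>j. j \<notin> I \<Longrightarrow> F_part ds j v = 0"
proof
  define I where "I = (\<Union>b<length ds. (\<lambda>m. int (monom_degree m) + ds ! b) ` keys (lookup v b))"
  show fin: "finite I"
    by (simp add: I_def)
  have mem: "int (monom_degree m) + ds ! b \<in> I" if "b < length ds" "lookup (lookup v b) m \<noteq> 0" for b m
    using that by (auto simp: I_def in_keys_iff intro!: bexI[of _ b])
  have *: "lookup (lookup v b) m = (\<Sum>j\<in>I. lookup (lookup (F_part ds j v) b) m)" for b m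
  proof (cases "b < length ds \<and> lookup (lookup v b) m \<noteq> 0")
    case True
    have "(\<Sum>j\<in>I. lookup (lookup (F_part ds j v) b) m) =
          (\<Sum>j\<in>I. if j = int (monom_degree m) + ds ! b then lookup (lookup v b) m else 0)"
      using True by (intro sum.cong) (auto simp: lookup_F_part lookup_hom_part)
    then show ?thesis
      using mem True fin by simp
  next
    case False
    then have "lookup (lookup (F_part ds j v) b) m = 0" for j
      by (auto simp: lookup_F_part lookup_hom_part)
    with False show ?thesis
      using F_carrierD[OF assms, of b] by fastforce
  qed
  show "v = (\<Sum>j\<in>I. F_part ds j v)"
    by (intro poly_mapping_eqI) (simp add: lookup_sum *)
  show "F_part ds j v = 0" if "j \<notin> I" for j
    using that mem by (intro poly_mapping_eqI) (force simp: lookup_F_part lookup_hom_part)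
qed

section \<open>Graded homomorphisms\<close>

definition graded_hom ::
    "int list \<Rightarrow> int list \<Rightarrow> (('n::finite, 'k::field) free \<Rightarrow> ('n, 'k) free) \<Rightarrow> bool" where
  "graded_hom ds es \<phi> \<longleftrightarrow> module_hom fscale fscale \<phi> \<and> (\<forall>j. \<phi> ` F_comp ds j \<subseteq> F_comp es j)"

lemma graded_hom_lin: "graded_hom ds es \<phi> \<Longrightarrow> module_hom fscale fscale \<phi>"
  by (simp add: graded_hom_def)

lemma graded_hom_comp: "graded_hom ds es \<phi> \<Longrightarrow> v \<in> F_comp ds j \<Longrightarrow> \<phi> v \<in> F_comp es j"
  by (auto simp: graded_hom_def)

lemma graded_homI:
  assumes "module_hom fscale fscale \<phi>" and "\<And>j v. v \<in> F_comp ds j \<Longrightarrow> \<phi> v \<in> F_comp es j"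
  shows "graded_hom ds es \<phi>"
  using assms by (auto simp: graded_hom_def)

text \<open>
  A homomorphism of degree \<open>0\<close> commutes with taking homogeneous parts: the image of a decomposition into
  homogeneous parts is again such a decomposition.
\<close>

lemma graded_hom_part:
  assumes "graded_hom ds es \<phi>" and "v \<in> F_carrier ds"
  shows "\<phi> (F_part ds j v) = F_part es j (\<phi> v)"
proof -
  interpret module_hom fscale fscale \<phi>
    using assms(1) by (rule graded_hom_lin)
  obtain I where I: "finite I" "v = (\<Sum>j\<in>I. F_part ds j v)" "\<And>j. j \<notin> I \<Longrightarrow> F_part ds j v = 0"
    using F_decompose[OF assms(2)] by blast
  have "F_part es j (\<phi> v) = (\<Sum>i\<in>I. F_part es j (\<phi> (F_part ds i v)))"
    using arg_cong[OF I(2), of "\<lambda>v. F_part es j (\<phi> v)"] by (simp add: sum F_part_sum)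
  also have "\<dots> = (\<Sum>i\<in>I. if i = j then \<phi> (F_part ds i v) else 0)"
    by (intro sum.cong refl F_part_F_comp graded_hom_comp[OF assms(1)] F_part_in_F_comp)
  also have "\<dots> = \<phi> (F_part ds j v)"
    using I(1,3) by auto
  finally show ?thesis ..
qed

lemma graded_hom_carrier:
  assumes "graded_hom ds es \<phi>" and "v \<in> F_carrier ds"
  shows "\<phi> v \<in> F_carrier es"
proof -
  interpret module_hom fscale fscale \<phi>
    using assms(1) by (rule graded_hom_lin)
  obtain I where "v = (\<Sum>j\<in>I. F_part ds j v)"
    using F_decompose[OF assms(2)] by blast
  then have "\<phi> v = (\<Sum>j\<in>I. \<phi> (F_part ds j v))"
    by (metis sum)
  also have "\<dots> \<in> F_carrier es"
    by (intro free.subspace_sum subspace_F_carrier)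
      (meson F_comp_carrier F_part_in_F_comp assms(1) graded_hom_comp)
  finally show ?thesis .
qed

text \<open>
  Any preimage of a homogeneous element can be replaced by its homogeneous part of the same degree.
\<close>

lemma homogeneous_preimage:
  assumes "graded_hom ds es \<phi>" and "y \<in> F_comp es j" and "y \<in> \<phi> ` F_carrier ds"
  obtains w where "w \<in> F_comp ds j" and "\<phi> w = y"
proof -
  obtain w where w: "w \<in> F_carrier ds" "y = \<phi> w"
    using assms(3) by blast
  have "\<phi> (F_part ds j w) = y"
    using graded_hom_part[OF assms(1) w(1)] F_part_F_comp[OF assms(2)] w(2) by simp
  then show thesis
    using that F_part_in_F_comp by blast
qed

lemma graded_hom_id: "graded_hom ds ds (\<lambda>v. v)"
  by (simp add: graded_hom_def free.module_hom_ident)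

lemma graded_hom_0: "graded_hom ds es (\<lambda>v. 0)"
  by (auto simp: graded_hom_def module_hom_iff module_fscale)

lemma graded_hom_diff:
  assumes "graded_hom ds es \<phi>" and "graded_hom ds es \<psi>"
  shows "graded_hom ds es (\<lambda>v. \<phi> v - \<psi> v)"
proof (rule graded_homI)
  show "module_hom fscale fscale (\<lambda>v. \<phi> v - \<psi> v)"
    using assms by (simp add: graded_hom_def module_hom_iff algebra_simps)
qed (intro F_comp_diff graded_hom_comp[OF assms(1)] graded_hom_comp[OF assms(2)])

lemma graded_hom_compose:
  assumes "graded_hom ds es \<phi>" and "graded_hom es fs \<psi>"
  shows "graded_hom ds fs (\<lambda>v. \<psi> (\<phi> v))"
proof (rule graded_homI)
  show "module_hom fscale fscale (\<lambda>v. \<psi> (\<phi> v))"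
    using module_hom_compose[OF graded_hom_lin graded_hom_lin, OF assms] by (simp add: o_def)
qed (intro graded_hom_comp[OF assms(2)] graded_hom_comp[OF assms(1)])

definition free_extend ::
    "nat \<Rightarrow> (nat \<Rightarrow> ('n, 'k::field) free) \<Rightarrow> ('n, 'k) free \<Rightarrow> ('n, 'k) free" where
  "free_extend n g v = (\<Sum>b<n. fscale (lookup v b) (g b))"

lemma free_extend_lin: "module_hom fscale fscale (free_extend n g)"
  by (simp add: module_hom_iff module_fscale free_extend_def lookup_add lookup_fscale
      free.scale_left_distrib sum.distrib free.scale_sum_right)

lemma graded_free_extend:
  assumes "\<And>b. b < length ds \<Longrightarrow> g b \<in> F_comp es (ds ! b)"
  shows "graded_hom ds es (free_extend (length ds) g)"
proof -
  have "free_extend (length ds) g v \<in> F_comp es j" if "v \<in> F_comp ds j" for v j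
    unfolding free_extend_def
  proof (rule F_comp_sum)
    fix b assume "b \<in> {..<length ds}"
    then have "b < length ds" by simp
    from F_comp_fscale[OF F_compD[OF that this] assms[OF this]]
    show "fscale (lookup v b) (g b) \<in> F_comp es j" by simp
  qed
  then show ?thesis
    by (auto simp: graded_hom_def free_extend_lin)
qed

lemma basis_in_F_comp: "b < length ds \<Longrightarrow> single b 1 \<in> F_comp ds (ds ! b)"
  by (auto simp: F_comp_def F_carrier_def lookup_single when_def S_comp_1)

lemma basis_expansion:
  assumes "v \<in> F_carrier ds"
  shows "v = (\<Sum>b<length ds. fscale (lookup v b) (single b 1))"
proof (rule poly_mapping_eqI)
  fix b
  show "lookup v b = lookup (\<Sum>b<length ds. fscale (lookup v b) (single b 1)) b"
    using F_carrierD[OF assms, of b]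
    by (cases "b < length ds") (simp_all add: lookup_sum lookup_fscale lookup_single when_def if_distrib cong: if_cong)
qed

text \<open>
  Graded free modules are projective. The lift sends each basis element to a homogeneous preimage of its
  image, which makes it a homomorphism of degree \<open>0\<close>.
\<close>

lemma graded_lift:
  fixes \<phi> \<delta> :: "('n::finite, 'k::field) free \<Rightarrow> ('n, 'k) free"
  assumes \<phi>: "graded_hom ds es \<phi>" and \<delta>: "graded_hom es' es \<delta>"
    and im: "\<And>v. v \<in> F_carrier ds \<Longrightarrow> \<phi> v \<in> \<delta> ` F_carrier es'"
  obtains \<psi> where "graded_hom ds es' \<psi>" and "\<And>v. v \<in> F_carrier ds \<Longrightarrow> \<delta> (\<psi> v) = \<phi> v"
proof -
  interpret \<phi>: module_hom fscale fscale \<phi> using \<phi> by (rule graded_hom_lin)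
  interpret \<delta>: module_hom fscale fscale \<delta> using \<delta> by (rule graded_hom_lin)
  have "\<exists>w. w \<in> F_comp es' (ds ! b) \<and> \<delta> w = \<phi> (single b 1)" if "b < length ds" for b
    using basis_in_F_comp[OF that] homogeneous_preimage[OF \<delta>] graded_hom_comp[OF \<phi>] im
    by (metis F_comp_carrier)
  then obtain g where g: "\<And>b. b < length ds \<Longrightarrow> g b \<in> F_comp es' (ds ! b)"
      "\<And>b. b < length ds \<Longrightarrow> \<delta> (g b) = \<phi> (single b 1)"
    by metis
  show thesis
  proof
    show "graded_hom ds es' (free_extend (length ds) g)"
      using g(1) by (rule graded_free_extend)
    fix v :: "('n, 'k) free" assume "v \<in> F_carrier ds"
    from arg_cong[OF basis_expansion[OF this], of \<phi>]
    show "\<delta> (free_extend (length ds) g v) = \<phi> v"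
      by (simp add: free_extend_def \<phi>.sum \<delta>.sum \<phi>.scale \<delta>.scale g(2))
  qed
qed

section \<open>Chain maps and homotopies\<close>

text \<open>
  A graded free complex that is exact in all positions except \<open>0\<close>. Below, position \<open>0\<close> holds the ring
  itself, so that an augmented resolution of an ideal is a complex of this kind.
\<close>

definition exact_complex ::
    "(nat \<Rightarrow> int list) \<Rightarrow> (nat \<Rightarrow> ('n::finite, 'k::field) free \<Rightarrow> ('n, 'k) free) \<Rightarrow> bool" where
  "exact_complex ds \<delta> \<longleftrightarrow> (\<forall>i. graded_hom (ds (Suc i)) (ds i) (\<delta> i)) \<and>
     (\<forall>i. {v \<in> F_carrier (ds (Suc i)). \<delta> i v = 0} = \<delta> (Suc i) ` F_carrier (ds (Suc (Suc i))))"

lemma exact_complex_hom: "exact_complex ds \<delta> \<Longrightarrow> graded_hom (ds (Suc i)) (ds i) (\<delta> i)"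
  by (simp add: exact_complex_def)

lemma exact_complex_exact:
  "exact_complex ds \<delta> \<Longrightarrow> v \<in> F_carrier (ds (Suc i)) \<Longrightarrow> \<delta> i v = 0 \<Longrightarrow>
     v \<in> \<delta> (Suc i) ` F_carrier (ds (Suc (Suc i)))"
  unfolding exact_complex_def by blast

lemma exact_complex_square:
  "exact_complex ds \<delta> \<Longrightarrow> v \<in> F_carrier (ds (Suc (Suc i))) \<Longrightarrow> \<delta> i (\<delta> (Suc i) v) = 0"
  unfolding exact_complex_def by blast

definition chain_map ::
    "(nat \<Rightarrow> int list) \<Rightarrow> (nat \<Rightarrow> ('n::finite, 'k::field) free \<Rightarrow> ('n, 'k) free) \<Rightarrow>
     (nat \<Rightarrow> int list) \<Rightarrow> (nat \<Rightarrow> ('n, 'k) free \<Rightarrow> ('n, 'k) free) \<Rightarrow>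
     (nat \<Rightarrow> ('n, 'k) free \<Rightarrow> ('n, 'k) free) \<Rightarrow> bool" where
  "chain_map ds \<delta> es \<epsilon> f \<longleftrightarrow> (\<forall>i. graded_hom (ds i) (es i) (f i)) \<and>
     (\<forall>i. \<forall>v\<in>F_carrier (ds (Suc i)). \<epsilon> i (f (Suc i) v) = f i (\<delta> i v))"

text \<open>
  The maps are constructed one after the other: once \<open>f i\<close> commutes with the differentials, the image of
  \<open>f i \<circ> \<delta> i\<close> consists of cycles, hence of boundaries, and \<open>graded_lift\<close> yields \<open>f (i + 1)\<close>. The
  hypothesis on the images starts this at position \<open>0\<close>, where the target need not be exact.
\<close>

lemma chain_map_lift:
  fixes ds es :: "nat \<Rightarrow> int list"
    and \<delta> \<epsilon> :: "nat \<Rightarrow> ('n::finite, 'k::field) free \<Rightarrow> ('n, 'k) free"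
  assumes D: "exact_complex ds \<delta>" and E: "exact_complex es \<epsilon>" and f0: "graded_hom (ds 0) (es 0) f0"
    and im: "\<And>v. v \<in> F_carrier (ds 1) \<Longrightarrow> f0 (\<delta> 0 v) \<in> \<epsilon> 0 ` F_carrier (es 1)"
  obtains f where "f 0 = f0" and "chain_map ds \<delta> es \<epsilon> f"
proof -
  define P where "P i g \<longleftrightarrow> graded_hom (ds i) (es i) g \<and>
    (\<forall>v\<in>F_carrier (ds (Suc i)). g (\<delta> i v) \<in> \<epsilon> i ` F_carrier (es (Suc i))) \<and> (i = 0 \<longrightarrow> g = f0)"
    for i and g :: "('n, 'k) free \<Rightarrow> ('n, 'k) free"
  define Q where "Q i g h \<longleftrightarrow> (\<forall>v\<in>F_carrier (ds (Suc i)). \<epsilon> i (h v) = g (\<delta> i v))"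
    for i and g h :: "('n, 'k) free \<Rightarrow> ('n, 'k) free"
  have "\<exists>f. \<forall>i. P i (f i) \<and> Q i (f i) (f (Suc i))"
  proof (rule dependent_nat_choice)
    show "\<exists>g. P 0 g"
      using f0 im by (auto simp: P_def)
    fix g i assume "P i g"
    then have g: "graded_hom (ds i) (es i) g"
        "\<And>v. v \<in> F_carrier (ds (Suc i)) \<Longrightarrow> g (\<delta> i v) \<in> \<epsilon> i ` F_carrier (es (Suc i))"
      by (auto simp: P_def)
    have "graded_hom (ds (Suc i)) (es i) (\<lambda>v. g (\<delta> i v))"
      using exact_complex_hom[OF D] g(1) by (rule graded_hom_compose)
    then obtain h where h: "graded_hom (ds (Suc i)) (es (Suc i)) h"
        "\<And>v. v \<in> F_carrier (ds (Suc i)) \<Longrightarrow> \<epsilon> i (h v) = g (\<delta> i v)"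
      by (rule graded_lift[OF _ exact_complex_hom[OF E] g(2)]) blast+
    have "h (\<delta> (Suc i) v) \<in> \<epsilon> (Suc i) ` F_carrier (es (Suc (Suc i)))"
      if v: "v \<in> F_carrier (ds (Suc (Suc i)))" for v
    proof (rule exact_complex_exact[OF E])
      have w: "\<delta> (Suc i) v \<in> F_carrier (ds (Suc i))"
        using graded_hom_carrier[OF exact_complex_hom[OF D] v] .
      then show "h (\<delta> (Suc i) v) \<in> F_carrier (es (Suc i))"
        using graded_hom_carrier[OF h(1)] by blast
      show "\<epsilon> i (h (\<delta> (Suc i) v)) = 0"
        using h(2)[OF w] exact_complex_square[OF D v] module_hom.zero[OF graded_hom_lin[OF g(1)]]
        by simp
    qed
    then show "\<exists>h. P (Suc i) h \<and> Q i g h"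
      using h by (intro exI[of _ h]) (auto simp: P_def Q_def)
  qed
  then obtain f where f: "\<And>i. P i (f i)" "\<And>i. Q i (f i) (f (Suc i))"
    by blast
  then have "f 0 = f0" "chain_map ds \<delta> es \<epsilon> f"
    by (auto simp: P_def Q_def chain_map_def)
  then show thesis by (rule that)
qed

text \<open>
  The homotopy is also constructed step by step: \<open>\<phi> (i + 1) - h i \<circ> \<delta> i\<close> takes values in cycles because
  \<open>\<delta> i \<circ> \<phi> (i + 1) = \<phi> i \<circ> \<delta> i\<close> and \<open>\<delta> i \<circ> h i \<circ> \<delta> i = \<phi> i \<circ> \<delta> i\<close>, and \<open>h (i + 1)\<close> is a lift of it.
\<close>

lemma chain_map_homotopy:
  fixes ds :: "nat \<Rightarrow> int list"
    and \<delta> \<phi> :: "nat \<Rightarrow> ('n::finite, 'k::field) free \<Rightarrow> ('n, 'k) free"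
  assumes D: "exact_complex ds \<delta>" and \<phi>: "chain_map ds \<delta> ds \<delta> \<phi>" and \<phi>0: "\<And>v. \<phi> 0 v = 0"
  obtains h where "\<And>v. h 0 v = 0" and "\<And>i. graded_hom (ds i) (ds (Suc i)) (h i)"
    and "\<And>i v. v \<in> F_carrier (ds (Suc i)) \<Longrightarrow> \<phi> (Suc i) v = \<delta> (Suc i) (h (Suc i) v) + h i (\<delta> i v)"
proof -
  define P where "P i g \<longleftrightarrow> graded_hom (ds i) (ds (Suc i)) g \<and>
    (\<forall>v\<in>F_carrier (ds (Suc i)). \<delta> i (g (\<delta> i v)) = \<phi> i (\<delta> i v)) \<and> (i = 0 \<longrightarrow> g = (\<lambda>v. 0))"
    for i and g :: "('n, 'k) free \<Rightarrow> ('n, 'k) free"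
  define Q where "Q i g h \<longleftrightarrow> (\<forall>v\<in>F_carrier (ds (Suc i)). \<phi> (Suc i) v = \<delta> (Suc i) (h v) + g (\<delta> i v))"
    for i and g h :: "('n, 'k) free \<Rightarrow> ('n, 'k) free"
  have lin: "module_hom fscale fscale (\<delta> i)" for i
    using graded_hom_lin[OF exact_complex_hom[OF D]] .
  have \<phi>h: "graded_hom (ds i) (ds i) (\<phi> i)" for i
    using \<phi> by (simp add: chain_map_def)
  have "\<exists>f. \<forall>i. P i (f i) \<and> Q i (f i) (f (Suc i))"
  proof (rule dependent_nat_choice)
    show "\<exists>g. P 0 g"
      using \<phi>0 module_hom.zero[OF lin, of 0] by (auto simp: P_def graded_hom_0)
    fix g i assume "P i g"
    then have g: "graded_hom (ds i) (ds (Suc i)) g"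
        "\<And>v. v \<in> F_carrier (ds (Suc i)) \<Longrightarrow> \<delta> i (g (\<delta> i v)) = \<phi> i (\<delta> i v)"
      by (auto simp: P_def)
    have hom: "graded_hom (ds (Suc i)) (ds (Suc i)) (\<lambda>v. \<phi> (Suc i) v - g (\<delta> i v))"
      by (intro graded_hom_diff \<phi>h graded_hom_compose[OF exact_complex_hom[OF D] g(1)])
    obtain h where h: "graded_hom (ds (Suc i)) (ds (Suc (Suc i))) h"
        "\<And>v. v \<in> F_carrier (ds (Suc i)) \<Longrightarrow> \<delta> (Suc i) (h v) = \<phi> (Suc i) v - g (\<delta> i v)"
    proof (rule graded_lift[OF hom exact_complex_hom[OF D]])
      fix v :: "('n, 'k) free" assume v: "v \<in> F_carrier (ds (Suc i))"
      show "\<phi> (Suc i) v - g (\<delta> i v) \<in> \<delta> (Suc i) ` F_carrier (ds (Suc (Suc i)))"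
      proof (rule exact_complex_exact[OF D])
        show "\<phi> (Suc i) v - g (\<delta> i v) \<in> F_carrier (ds (Suc i))"
          using graded_hom_carrier[OF hom v] .
        show "\<delta> i (\<phi> (Suc i) v - g (\<delta> i v)) = 0"
          using g(2)[OF v] \<phi> v by (simp add: module_hom.diff[OF lin] chain_map_def)
      qed
    qed blast
    have "\<delta> (Suc i) (h (\<delta> (Suc i) v)) = \<phi> (Suc i) (\<delta> (Suc i) v)"
      if v: "v \<in> F_carrier (ds (Suc (Suc i)))" for v
    proof -
      have w: "\<delta> (Suc i) v \<in> F_carrier (ds (Suc i))"
        using graded_hom_carrier[OF exact_complex_hom[OF D] v] .
      then show ?thesis
        using h(2)[OF w] exact_complex_square[OF D v] module_hom.zero[OF graded_hom_lin[OF g(1)]]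
        by simp
    qed
    then show "\<exists>h. P (Suc i) h \<and> Q i g h"
      using h by (intro exI[of _ h]) (auto simp: P_def Q_def)
  qed
  then obtain f where f: "\<And>i. P i (f i)" "\<And>i. Q i (f i) (f (Suc i))"
    by blast
  show thesis
  proof (rule that)
    show "f 0 v = 0" for v
      using f(1)[of 0] by (simp add: P_def)
    show "graded_hom (ds i) (ds (Suc i)) (f i)" for i
      using f(1)[of i] by (simp add: P_def)
    show "\<phi> (Suc i) v = \<delta> (Suc i) (f (Suc i) v) + f i (\<delta> i v)"
      if "v \<in> F_carrier (ds (Suc i))" for i and v :: "('n, 'k) free"
      using f(2)[of i] that unfolding Q_def by blast
  qed
qed

section \<open>Independence of Betti numbers from the resolution\<close>

text \<open>
  The hypotheses say that \<open>f\<close> induces an injective map \<open>Z / B \<rightarrow> Z' / B'\<close>. A basis of \<open>B\<close> is extended to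
  a basis of \<open>Z\<close>; the images of the added vectors are then linearly independent of a basis of \<open>B'\<close>. The
  finite spanning sets matter, as \<open>dim\<close> is \<open>0\<close> on spaces of infinite dimension.
\<close>

lemma (in vector_space) dim_quotient_le:
  assumes f: "module_hom scale scale f"
    and B: "subspace B" "B \<subseteq> Z" and Z: "subspace Z" "Z \<subseteq> span T" "finite T"
    and B': "subspace B'" "B' \<subseteq> Z'" and Z': "Z' \<subseteq> span T'" "finite T'"
    and fZ: "f ` Z \<subseteq> Z'" and inj: "\<And>v. v \<in> Z \<Longrightarrow> f v \<in> B' \<Longrightarrow> v \<in> B"
  shows "dim Z - dim B \<le> dim Z' - dim B'"
proof -
  interpret f: module_hom scale scale f by (rule f)
  obtain D where D: "D \<subseteq> B" "independent D" "B \<subseteq> span D"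
    using maximal_independent_subset .
  obtain E where E: "D \<subseteq> E" "E \<subseteq> Z" "independent E" "Z \<subseteq> span E"
    using maximal_independent_subset_extend[OF subset_trans[OF D(1) B(2)] D(2)] .
  obtain D' where D': "D' \<subseteq> B'" "independent D'" "B' \<subseteq> span D'"
    using maximal_independent_subset .
  have finE: "finite E"
    using independent_span_bound[OF Z(3) E(3)] E(2) Z(2) by blast
  have finD': "finite D'"
    using independent_span_bound[OF Z'(2) D'(2)] D'(1) B'(2) Z'(1) by blast
  have spD: "span D \<subseteq> B" and spD': "span D' \<subseteq> B'"
    using span_minimal B(1) B'(1) D(1) D'(1) by auto
  have "independent (D' \<union> f ` X) \<and> card (D' \<union> f ` X) = card D' + card X"
    if "finite X" "X \<subseteq> E - D" for X
    using that
  proof (induct X)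
    case (insert x X)
    have "f x \<notin> span (D' \<union> f ` X)"
    proof
      assume "f x \<in> span (D' \<union> f ` X)"
      then obtain b y where b: "b \<in> span D'" and y: "y \<in> span X" and eq: "f x = b + f y"
        by (auto simp: span_Un f.span_image)
      have "y \<in> Z"
        using y span_minimal[OF _ Z(1), of X] insert.prems E(2) by auto
      moreover have "x \<in> Z"
        using insert.prems E(2) by auto
      ultimately have "x - y \<in> B"
        using inj[of "x - y"] subspace_diff[OF Z(1)] b spD' eq by (auto simp: f.diff)
      then have "x \<in> span (D \<union> X)"
        using D(3) y span_mono[of D "D \<union> X"] span_mono[of X "D \<union> X"]
          span_add[of "x - y" "D \<union> X" y] by auto
      moreover have "D \<union> X \<subseteq> E - {x}"
        using E(1) insert.prems insert.hyps(2) by auto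
      ultimately have "x \<in> span (E - {x})"
        by (meson in_mono span_mono)
      then show False
        using E(3) insert.prems unfolding dependent_def by blast
    qed
    moreover from this have "f x \<notin> D' \<union> f ` X"
      using span_base[of "f x" "D' \<union> f ` X"] by metis
    ultimately show ?case
      using insert finD' by (simp add: independent_insertI)
  qed (simp add: D')
  from this[of "E - D"] have ind: "independent (D' \<union> f ` (E - D))"
      and card: "card (D' \<union> f ` (E - D)) = card D' + card (E - D)"
    using finE by auto
  have sub: "D' \<union> f ` (E - D) \<subseteq> Z'"
    using subset_trans[OF D'(1) B'(2)] E(2) fZ by blast
  have "card D' + card (E - D) \<le> dim Z'"
  proof -
    obtain C where C: "D' \<union> f ` (E - D) \<subseteq> C" "C \<subseteq> Z'" "independent C" "Z' \<subseteq> span C"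
      using maximal_independent_subset_extend[OF sub ind] .
    have "finite C"
      using independent_span_bound[OF Z'(2) C(3)] C(2) Z'(1) by blast
    then have "card (D' \<union> f ` (E - D)) \<le> card C"
      using C(1) card_mono by blast
    then show ?thesis
      using card basis_card_eq_dim[OF C(2,4,3)] by simp
  qed
  moreover have "card E = dim Z" "card D = dim B" "card D' = dim B'"
    using basis_card_eq_dim[OF E(2,4,3)] basis_card_eq_dim[OF D(1,3,2)] basis_card_eq_dim[OF D'(1,3,2)]
    by simp_all
  moreover have "card (E - D) = card E - card D"
    using finE E(1) by (simp add: card_Diff_subset finite_subset)
  ultimately show ?thesis by linarith
qed

lemma finite_monomials_of_degree: "finite {m :: 'n::finite \<Rightarrow>\<^sub>0 nat. int (monom_degree m) = d}"
proof (rule finite_imageD)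
  show inj: "inj_on lookup {m :: 'n \<Rightarrow>\<^sub>0 nat. int (monom_degree m) = d}"
    by (rule inj_onI) (simp only: lookup_inject)
  have "lookup m i \<le> nat d" if "int (monom_degree m) = d" for m :: "'n \<Rightarrow>\<^sub>0 nat" and i
    using that member_le_sum[of i UNIV "lookup m"] by (auto simp: monom_degree_def simp del: of_nat_sum)
  then have "lookup ` {m :: 'n \<Rightarrow>\<^sub>0 nat. int (monom_degree m) = d} \<subseteq>
      {f. \<forall>i. (i \<in> UNIV \<longrightarrow> f i \<in> {..nat d}) \<and> (i \<notin> UNIV \<longrightarrow> f i = 0)}"
    by auto
  then show "finite (lookup ` {m :: 'n \<Rightarrow>\<^sub>0 nat. int (monom_degree m) = d})"
    by (rule finite_subset) (intro finite_set_of_finite_funs finite finite_atMost)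
qed

text \<open>
  The vectors with a single nonzero coordinate, which is a monomial of the right degree, span.
\<close>

lemma F_comp_finite_dim:
  obtains T :: "('n::finite, 'k::field) free set" where "finite T" and "F_comp ds j \<subseteq> kfree.span T"
proof
  define T :: "('n, 'k) free set" where
    "T = (\<Union>b<length ds. (\<lambda>m. single b (single m 1)) ` {m. int (monom_degree m) = j - ds ! b})"
  show "finite T"
    by (simp add: T_def finite_monomials_of_degree)
  show "F_comp ds j \<subseteq> kfree.span T"
  proof
    fix v :: "('n, 'k) free" assume v: "v \<in> F_comp ds j"
    have ks: "kscale c (single b (single m 1)) = single b (single m c)" for c :: 'k and b m
      by (rule poly_mapping_eqI)
        (simp add: kscale_def lookup_fscale Const_def lookup_single when_def mult_single)
    have single_sum: "single b p = (\<Sum>m\<in>keys p. kscale (lookup p m) (single b (single m 1)))"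
      for b and p :: "('n, 'k) mpoly"
    proof (rule poly_mapping_eqI)
      fix b'
      show "lookup (single b p) b' = lookup (\<Sum>m\<in>keys p. kscale (lookup p m) (single b (single m 1))) b'"
        using mpoly_expansion[of p] by (cases "b = b'") (simp_all add: ks lookup_sum lookup_single when_def)
    qed
    have "v = (\<Sum>b<length ds. single b (lookup v b))"
      using F_carrierD[OF F_comp_carrier[OF v]]
      by (intro poly_mapping_eqI) (simp add: lookup_sum lookup_single when_def)
    also have "\<dots> = (\<Sum>b<length ds. \<Sum>m\<in>keys (lookup v b).
        kscale (lookup (lookup v b) m) (single b (single m 1)))"
      by (intro sum.cong refl single_sum)
    also have "\<dots> \<in> kfree.span T"
    proof (intro kfree.span_sum kfree.span_scale kfree.span_base)
      fix b m assume "b \<in> {..<length ds}" and "m \<in> keys (lookup v b)"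
      then show "single b (single m 1) \<in> T"
        using S_compD[OF F_compD[OF v], of b m] by (auto simp: T_def in_keys_iff)
    qed
    finally show "v \<in> kfree.span T" .
  qed
qed

text \<open>
  The augmentation \<open>F\<^sub>0 \<rightarrow> M \<subseteq> S\<close> of a resolution is treated as one more differential, into the free module
  \<open>S\<close> of rank one. The position of \<open>F\<^sub>i\<close> in the augmented complex is \<open>i + 1\<close>.
\<close>

definition augmented_degrees :: "(nat \<Rightarrow> int list) \<Rightarrow> nat \<Rightarrow> int list" where
  "augmented_degrees ds i = (case i of 0 \<Rightarrow> [0] | Suc i' \<Rightarrow> ds i')"

definition augmented_maps ::
    "(('n, 'k::field) free \<Rightarrow> ('n, 'k) mpoly) \<Rightarrow> (nat \<Rightarrow> ('n, 'k) free \<Rightarrow> ('n, 'k) free) \<Rightarrow>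
     nat \<Rightarrow> ('n, 'k) free \<Rightarrow> ('n, 'k) free" where
  "augmented_maps aug \<delta> i = (case i of 0 \<Rightarrow> \<lambda>v. single 0 (aug v) | Suc i' \<Rightarrow> \<delta> i')"

lemma augmented_simps [simp]:
  "augmented_degrees ds 0 = [0]" "augmented_degrees ds (Suc i) = ds i"
  "augmented_maps aug \<delta> 0 = (\<lambda>v. single 0 (aug v))" "augmented_maps aug \<delta> (Suc i) = \<delta> i"
  by (simp_all add: augmented_degrees_def augmented_maps_def)

lemma fscale_single: "fscale p (single b q) = single b (p * q)"
  by (rule poly_mapping_eqI) (simp add: lookup_fscale lookup_single when_def)

lemma single_eq_0_iff [simp]: "single b p = 0 \<longleftrightarrow> p = 0"
  by (metis lookup_single_eq lookup_zero single_zero)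

lemma resolution_complex:
  assumes R: "graded_free_resolution M ds aug \<delta>"
  shows "exact_complex (augmented_degrees ds) (augmented_maps aug \<delta>)"
  unfolding exact_complex_def
proof (intro conjI allI)
  fix i
  show "graded_hom (augmented_degrees ds (Suc i)) (augmented_degrees ds i) (augmented_maps aug \<delta> i)"
  proof (cases i)
    case 0
    have "module_hom fscale (*) aug" "\<And>j. aug ` F_comp (ds 0) j \<subseteq> S_comp j"
      using R by (auto simp: graded_free_resolution_def)
    then have "module_hom fscale fscale (\<lambda>v. single 0 (aug v))"
        "\<And>j v. v \<in> F_comp (ds 0) j \<Longrightarrow> single 0 (aug v) \<in> F_comp [0] j"
      by (auto simp: module_hom_iff module_fscale single_add fscale_single F_comp_def F_carrier_def)
    then show ?thesis
      using 0 by (simp add: graded_homI)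
  next
    case (Suc i')
    then show ?thesis
      using R by (simp add: graded_free_resolution_def graded_hom_def)
  qed
  show "{v \<in> F_carrier (augmented_degrees ds (Suc i)). augmented_maps aug \<delta> i v = 0} =
      augmented_maps aug \<delta> (Suc i) ` F_carrier (augmented_degrees ds (Suc (Suc i)))"
    using R by (cases i) (simp_all add: graded_free_resolution_def)
qed

lemma resolution_image:
  "graded_free_resolution M ds aug \<delta> \<Longrightarrow> (\<lambda>v. single 0 (aug v)) ` F_carrier (ds 0) = single 0 ` M"
  by (auto simp: graded_free_resolution_def)

lemma resolution_chain_map:
  fixes M N :: "('n::finite, 'k::field) mpoly set"
  assumes "graded_free_resolution M ds aug \<delta>" and "graded_free_resolution N es aug' \<epsilon>" and "M \<subseteq> N"
  obtains f where "f 0 = (\<lambda>v. v)"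
    and "chain_map (augmented_degrees ds) (augmented_maps aug \<delta>)
           (augmented_degrees es) (augmented_maps aug' \<epsilon>) f"
proof (rule chain_map_lift[OF resolution_complex[OF assms(1)] resolution_complex[OF assms(2)]])
  show "graded_hom (augmented_degrees ds 0) (augmented_degrees es 0) (\<lambda>v. v)"
    by (simp add: graded_hom_id)
  show "augmented_maps aug \<delta> 0 v \<in> augmented_maps aug' \<epsilon> 0 ` F_carrier (augmented_degrees es 1)"
    if "v \<in> F_carrier (augmented_degrees ds 1)" for v
  proof -
    have "augmented_maps aug \<delta> 0 v \<in> single 0 ` M"
      using that unfolding resolution_image[OF assms(1), symmetric] by simp
    also have "\<dots> \<subseteq> single 0 ` N"
      using assms(3) by (rule image_mono)
    also have "\<dots> = augmented_maps aug' \<epsilon> 0 ` F_carrier (augmented_degrees es 1)"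
      by (simp add: resolution_image[OF assms(2)])
    finally show ?thesis .
  qed
qed blast

lemma resolution_comparison:
  fixes M N :: "('n::finite, 'k::field) mpoly set"
  assumes "graded_free_resolution M ds aug \<delta>" and "graded_free_resolution N es aug' \<epsilon>" and "M \<subseteq> N"
  obtains f where "\<And>i. graded_hom (ds i) (es i) (f i)"
    and "\<And>i v. v \<in> F_carrier (ds (Suc i)) \<Longrightarrow> \<epsilon> i (f (Suc i) v) = f i (\<delta> i v)"
    and "\<And>v. v \<in> F_carrier (ds 0) \<Longrightarrow> aug' (f 0 v) = aug v"
proof -
  obtain f where f0: "f 0 = (\<lambda>v. v)"
      and f: "chain_map (augmented_degrees ds) (augmented_maps aug \<delta>)
           (augmented_degrees es) (augmented_maps aug' \<epsilon>) f"
    using resolution_chain_map[OF assms] .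
  have hom: "graded_hom (augmented_degrees ds i) (augmented_degrees es i) (f i)"
    and comm: "\<And>v. v \<in> F_carrier (augmented_degrees ds (Suc i)) \<Longrightarrow>
      augmented_maps aug' \<epsilon> i (f (Suc i) v) = f i (augmented_maps aug \<delta> i v)" for i
    using f by (simp_all add: chain_map_def)
  show thesis
  proof (rule that)
    show "graded_hom (ds i) (es i) (f (Suc i))" for i
      using hom[of "Suc i"] by simp
    show "\<epsilon> i (f (Suc (Suc i)) v) = f (Suc i) (\<delta> i v)" if "v \<in> F_carrier (ds (Suc i))" for i v
      using comm[of v "Suc i"] that by simp
    show "aug' (f (Suc 0) v) = aug v" if "v \<in> F_carrier (ds 0)" for v
      using comm[of v 0] that f0 by (simp add: inj_eq[OF inj_single])
  qed
qed

lemma mF_hom: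
  assumes "graded_hom ds es \<phi>" and "v \<in> mF ds"
  shows "\<phi> v \<in> mF es"
proof -
  interpret module_hom fscale fscale \<phi> using assms(1) by (rule graded_hom_lin)
  have "\<phi> v \<in> free.span (\<phi> ` {fscale p v | p v. p \<in> max_ideal \<and> v \<in> F_carrier ds})"
    using assms(2) by (auto simp: span_image mF_def)
  also have "\<dots> \<subseteq> mF es"
    unfolding mF_def
    by (rule free.span_mono) (use graded_hom_carrier[OF assms(1)] in \<open>fastforce simp: scale\<close>)
  finally show ?thesis .
qed

lemma subspace_mF: "kfree.subspace (mF ds)"
  unfolding mF_def
  by (rule kfree.subspaceI) (auto simp: kscale_def intro: free.span_zero free.span_add free.span_scale)

lemma module_hom_kscale: "module_hom fscale fscale \<phi> \<Longrightarrow> module_hom kscale kscale \<phi>"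
  using kfree.module_axioms by (simp add: module_hom_iff kscale_def)

lemma subspace_tor_cycles:
  assumes "graded_free_resolution M ds aug \<delta>"
  shows "kfree.subspace (tor_cycles ds \<delta> i j)"
proof (cases i)
  case 0
  then show ?thesis
    by (simp add: tor_cycles_def subspace_F_comp)
next
  case (Suc i')
  have "module_hom kscale kscale (\<delta> i')"
    using assms by (auto simp: graded_free_resolution_def intro: module_hom_kscale)
  then have "kfree.subspace {v. \<delta> i' v \<in> mF (ds i')}"
    using module_hom.subspace_linear_preimage subspace_mF by blast
  with subspace_F_comp have "kfree.subspace (F_comp (ds i) j \<inter> {v. \<delta> i' v \<in> mF (ds i')})"
    by (rule kfree.subspace_inter)
  then show ?thesis
    using Suc by (simp add: tor_cycles_def Int_def)
qed

lemma subspace_tor_boundaries: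
  assumes "graded_free_resolution M ds aug \<delta>"
  shows "kfree.subspace (tor_boundaries ds \<delta> i j)"
proof -
  have "module_hom kscale kscale (\<delta> i)"
    using assms by (auto simp: graded_free_resolution_def intro: module_hom_kscale)
  then have "kfree.subspace (\<delta> i ` F_comp (ds (Suc i)) j)"
    using module_hom.subspace_image subspace_F_comp by blast
  moreover have "kfree.subspace (mF (ds i) \<inter> F_comp (ds i) j)"
    by (intro kfree.subspace_inter subspace_mF subspace_F_comp)
  ultimately have "kfree.subspace {x + y | x y. x \<in> \<delta> i ` F_comp (ds (Suc i)) j \<and> y \<in> mF (ds i) \<inter> F_comp (ds i) j}"
    by (rule kfree.subspace_sums)
  also have "\<dots> = tor_boundaries ds \<delta> i j"
    by (auto simp: tor_boundaries_def)
  finally show ?thesis .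
qed

lemma tor_boundaries_subset:
  assumes R: "graded_free_resolution M ds aug \<delta>"
  shows "tor_boundaries ds \<delta> i j \<subseteq> tor_cycles ds \<delta> i j"
proof
  fix v assume "v \<in> tor_boundaries ds \<delta> i j"
  then obtain w u where v: "v = \<delta> i w + u" and w: "w \<in> F_comp (ds (Suc i)) j"
      and u: "u \<in> mF (ds i)" "u \<in> F_comp (ds i) j"
    by (auto simp: tor_boundaries_def)
  note X = resolution_complex[OF R]
  have hom: "graded_hom (ds (Suc i)) (ds i) (\<delta> i)" for i
    using exact_complex_hom[OF X, of "Suc i"] by simp
  have "v \<in> F_comp (ds i) j"
    using graded_hom_comp[OF hom w] u(2) v F_comp_add by blast
  moreover have "\<delta> i' v \<in> mF (ds i')" if "i = Suc i'" for i'
  proof -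
    have "\<delta> i' v = \<delta> i' u"
      using exact_complex_square[OF X, of w i] F_comp_carrier[OF w]
        module_hom.add[OF graded_hom_lin[OF hom]] v that by simp
    then show ?thesis
      using mF_hom[OF hom] u(1) that by simp
  qed
  ultimately show "v \<in> tor_cycles ds \<delta> i j"
    by (auto simp: tor_cycles_def split: nat.split)
qed

text \<open>
  Comparison maps \<open>f\<close> and \<open>g\<close> in the two directions exist, and \<open>g \<circ> f\<close> is homotopic to the identity.
  Consequently \<open>f\<close> is injective on Tor: if \<open>f v\<close> is a boundary modulo \<open>\<mm>\<close>, so is \<open>g (f v)\<close>, and it
  differs from \<open>v\<close> by \<open>\<delta> (h v) + h (\<delta> v)\<close>, whose second term lies in \<open>\<mm>F\<close> for a cycle \<open>v\<close>.
\<close>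

lemma tor_dim_le:
  fixes M :: "('n::finite, 'k::field) mpoly set"
  assumes R: "graded_free_resolution M ds aug \<delta>" and R': "graded_free_resolution M es aug' \<epsilon>"
  shows "tor_dim ds \<delta> i j \<le> tor_dim es \<epsilon> i j"
proof -
  define D \<Delta> where "D = augmented_degrees ds" and "\<Delta> = augmented_maps aug \<delta>"
  define E \<Gamma> where "E = augmented_degrees es" and "\<Gamma> = augmented_maps aug' \<epsilon>"
  note defs = D_def \<Delta>_def E_def \<Gamma>_def
  have X: "exact_complex D \<Delta>"
    unfolding defs using R by (rule resolution_complex)
  obtain f where f0: "f 0 = (\<lambda>v. v)" and f: "chain_map D \<Delta> E \<Gamma> f"
    unfolding defs using resolution_chain_map[OF R R' subset_refl] by blast
  obtain g where g0: "g 0 = (\<lambda>v. v)" and g: "chain_map E \<Gamma> D \<Delta> g"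
    unfolding defs using resolution_chain_map[OF R' R subset_refl] by blast
  have fh: "graded_hom (D i) (E i) (f i)" and gh: "graded_hom (E i) (D i) (g i)" for i
    using f g by (auto simp: chain_map_def)
  have fc: "\<Gamma> i (f (Suc i) v) = f i (\<Delta> i v)" if "v \<in> F_carrier (D (Suc i))" for i v
    using f that by (auto simp: chain_map_def)
  have gc: "\<Delta> i (g (Suc i) v) = g i (\<Gamma> i v)" if "v \<in> F_carrier (E (Suc i))" for i v
    using g that by (auto simp: chain_map_def)
  have dh: "graded_hom (D (Suc i)) (D i) (\<Delta> i)" for i
    using X by (rule exact_complex_hom)
  have "chain_map D \<Delta> D \<Delta> (\<lambda>i v. g i (f i v) - v)"
    unfolding chain_map_def
  proof (intro conjI allI ballI)
    fix i
    show "graded_hom (D i) (D i) (\<lambda>v. g i (f i v) - v)"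
      by (intro graded_hom_diff graded_hom_compose[OF fh gh] graded_hom_id)
    fix v :: "('n, 'k) free" assume v: "v \<in> F_carrier (D (Suc i))"
    have "f (Suc i) v \<in> F_carrier (E (Suc i))"
      using fh v by (rule graded_hom_carrier)
    then show "\<Delta> i (g (Suc i) (f (Suc i) v) - v) = g i (f i (\<Delta> i v)) - \<Delta> i v"
      by (simp add: module_hom.diff[OF graded_hom_lin[OF dh]] gc fc v)
  qed
  moreover have "g 0 (f 0 v) - v = 0" for v
    by (simp add: f0 g0)
  ultimately obtain h where h0: "\<And>v. h 0 v = 0"
      and hh: "\<And>i. graded_hom (D i) (D (Suc i)) (h i)"
      and hc: "\<And>i v. v \<in> F_carrier (D (Suc i)) \<Longrightarrow>
        g (Suc i) (f (Suc i) v) - v = \<Delta> (Suc i) (h (Suc i) v) + h i (\<Delta> i v)"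
    using chain_map_homotopy[OF X] by blast
  obtain T :: "('n, 'k) free set" where T: "finite T" "F_comp (ds i) j \<subseteq> kfree.span T"
    using F_comp_finite_dim .
  obtain T' :: "('n, 'k) free set" where T': "finite T'" "F_comp (es i) j \<subseteq> kfree.span T'"
    using F_comp_finite_dim .
  show ?thesis
    unfolding tor_dim_def
  proof (rule kfree.dim_quotient_le)
    show "module_hom kscale kscale (f (Suc i))"
      using graded_hom_lin[OF fh] by (rule module_hom_kscale)
    show "tor_cycles ds \<delta> i j \<subseteq> kfree.span T" "tor_cycles es \<epsilon> i j \<subseteq> kfree.span T'"
      using T(2) T'(2) by (auto simp: tor_cycles_def)
    show "f (Suc i) ` tor_cycles ds \<delta> i j \<subseteq> tor_cycles es \<epsilon> i j"
    proof
      fix y assume "y \<in> f (Suc i) ` tor_cycles ds \<delta> i j"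
      then obtain v where y: "y = f (Suc i) v" and v: "v \<in> tor_cycles ds \<delta> i j"
        by blast
      then have vc: "v \<in> F_comp (D (Suc i)) j"
        by (simp add: tor_cycles_def defs)
      have "\<epsilon> i' y \<in> mF (es i')" if i: "i = Suc i'" for i'
      proof -
        have "\<delta> i' v \<in> mF (ds i')"
          using v i by (simp add: tor_cycles_def)
        then have "f i (\<Delta> i v) \<in> mF (E i)"
          using mF_hom[OF fh[of i]] i by (simp add: defs)
        then show ?thesis
          using fc[OF F_comp_carrier[OF vc]] y i by (simp add: defs)
      qed
      moreover have "y \<in> F_comp (es i) j"
        using graded_hom_comp[OF fh vc] y by (simp add: defs)
      ultimately show "y \<in> tor_cycles es \<epsilon> i j"
        by (auto simp: tor_cycles_def split: nat.split)
    qed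
    fix v assume v: "v \<in> tor_cycles ds \<delta> i j" and b: "f (Suc i) v \<in> tor_boundaries es \<epsilon> i j"
    have vc: "v \<in> F_comp (D (Suc i)) j"
      using v by (simp add: tor_cycles_def defs)
    obtain w u where fv: "f (Suc i) v = \<epsilon> i w + u" and w: "w \<in> F_comp (es (Suc i)) j"
        and u: "u \<in> mF (es i)" "u \<in> F_comp (es i) j"
      using b by (auto simp: tor_boundaries_def)
    have wc: "w \<in> F_comp (E (Suc (Suc i))) j"
      using w by (simp add: defs)
    define w' where "w' = g (Suc (Suc i)) w - h (Suc i) v"
    define u' where "u' = g (Suc i) u - h i (\<Delta> i v)"
    have "g (Suc i) (f (Suc i) v) = g (Suc i) (\<Gamma> (Suc i) w) + g (Suc i) u"
      by (simp add: fv module_hom.add[OF graded_hom_lin[OF gh]] defs)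
    also have "g (Suc i) (\<Gamma> (Suc i) w) = \<Delta> (Suc i) (g (Suc (Suc i)) w)"
      using gc[OF F_comp_carrier[OF wc]] by simp
    finally have "v = \<Delta> (Suc i) (g (Suc (Suc i)) w) - \<Delta> (Suc i) (h (Suc i) v) + u'"
      using hc[OF F_comp_carrier[OF vc]] by (simp add: u'_def algebra_simps)
    then have "v = \<delta> i w' + u'"
      by (simp add: w'_def module_hom.diff[OF graded_hom_lin[OF dh], symmetric]) (simp add: defs)
    moreover have "w' \<in> F_comp (ds (Suc i)) j"
      using F_comp_diff[OF graded_hom_comp[OF gh wc] graded_hom_comp[OF hh vc]]
      by (simp add: w'_def defs)
    moreover have "u' \<in> F_comp (ds i) j"
      using F_comp_diff[OF graded_hom_comp[OF gh[of "Suc i"], of u j]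
          graded_hom_comp[OF hh[of i] graded_hom_comp[OF dh vc]]] u(2)
      by (simp add: u'_def defs)
    moreover have "u' \<in> mF (ds i)"
    proof -
      have "h i (\<Delta> i v) \<in> mF (D (Suc i))"
      proof (cases i)
        \<comment> \<open>The cycle condition is void for \<open>i = 0\<close>; there the homotopy is the zero map.\<close>
        case 0
        then show ?thesis
          by (simp add: h0 kfree.subspace_0[OF subspace_mF])
      next
        case (Suc i')
        then have "\<Delta> i v \<in> mF (D i)"
          using v by (simp add: tor_cycles_def defs)
        then show ?thesis
          by (rule mF_hom[OF hh])
      qed
      moreover have "g (Suc i) u \<in> mF (D (Suc i))"
        using mF_hom[OF gh[of "Suc i"]] u(1) by (simp add: defs)
      ultimately show ?thesis
        using kfree.subspace_diff[OF subspace_mF] by (fastforce simp: u'_def defs)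
    qed
    ultimately show "v \<in> tor_boundaries ds \<delta> i j"
      unfolding tor_boundaries_def by blast
  qed (use subspace_tor_cycles subspace_tor_boundaries tor_boundaries_subset R R' T T' in blast)+
qed

lemma betti_eq_tor_dim:
  assumes "graded_free_resolution M ds aug \<delta>"
  shows "betti M i j = tor_dim ds \<delta> i j"
  unfolding betti_def
  by (rule the_equality) (use assms in \<open>blast intro: order_antisym tor_dim_le\<close>)+

section \<open>Linear resolutions\<close>

text \<open>
  Linearity is encoded in the degrees of the free modules alone. It forces the entries of all differentials
  to be linear forms, so such a resolution is minimal.
\<close>

definition linear_degrees :: "int \<Rightarrow> (nat \<Rightarrow> nat) \<Rightarrow> nat \<Rightarrow> int list" where
  "linear_degrees d r i = replicate (r i) (d + int i)"

definition linear_resolution :: "('n::finite, 'k::field) mpoly set \<Rightarrow> int \<Rightarrow> (nat \<Rightarrow> nat) \<Rightarrow> bool" where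
  "linear_resolution M d r \<longleftrightarrow> (\<exists>aug \<delta>. graded_free_resolution M (linear_degrees d r) aug \<delta>)"

text \<open>
  The homogeneous elements of a graded free module whose generators all have the same degree.
\<close>

definition hom_vectors :: "nat \<Rightarrow> int \<Rightarrow> ('n::finite, 'k::field) free set" where
  "hom_vectors n e = {v. (\<forall>k\<ge>n. lookup v k = 0) \<and> (\<forall>k. lookup v k \<in> S_comp e)}"

lemma F_carrier_linear: "v \<in> F_carrier (linear_degrees d r i) \<longleftrightarrow> (\<forall>k\<ge>r i. lookup v k = 0)"
  by (force simp: F_carrier_def linear_degrees_def in_keys_iff not_le[symmetric])

lemma F_comp_linear: "F_comp (linear_degrees d r i) j = hom_vectors (r i) (j - d - int i)"
  unfolding F_comp_def hom_vectors_def F_carrier_linear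
  by (auto simp: linear_degrees_def diff_diff_eq) (metis S_comp_0 not_le)

lemma X_in_max_ideal: "X i * p \<in> max_ideal"
  unfolding max_ideal_def
  using mpoly.span_scale[OF mpoly.span_base[of "X i" "range X"], of p] by (simp add: mult.commute)

lemma S_comp_max_ideal:
  fixes p :: "('n::finite, 'k::field) mpoly"
  assumes "p \<in> S_comp j" and "j \<ge> 1"
  shows "p \<in> max_ideal"
proof -
  have "single m c \<in> (max_ideal :: ('n, 'k) mpoly set)" if "monom_degree m \<noteq> 0" for m and c :: 'k
  proof -
    have "\<not> (\<forall>i. lookup m i = 0)"
      using that by (simp add: monom_degree_def)
    then obtain i where "lookup m i \<noteq> 0"
      by blast
    then have "m = single i 1 + (m - single i 1)"
      by (intro poly_mapping_eqI) (auto simp: lookup_add lookup_minus lookup_single when_def)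
    then have "single m c = X i * single (m - single i 1) c"
      by (simp add: X_def mult_single)
    then show ?thesis
      by (simp add: X_in_max_ideal)
  qed
  then have "(\<Sum>m\<in>keys p. single m (lookup p m)) \<in> max_ideal"
    using S_compD[OF assms(1)] assms(2) unfolding max_ideal_def
    by (intro mpoly.span_sum) (force simp: in_keys_iff)
  also have "(\<Sum>m\<in>keys p. single m (lookup p m)) = p"
    by (rule mpoly_expansion[symmetric])
  finally show ?thesis .
qed

lemma mFI:
  fixes v :: "('n::finite, 'k::field) free"
  assumes v: "v \<in> F_carrier ds" and "\<And>b. b < length ds \<Longrightarrow> lookup v b \<in> max_ideal"
  shows "v \<in> mF ds"
proof -
  have "(\<Sum>b<length ds. fscale (lookup v b) (single b 1)) \<in> mF ds"
    unfolding mF_def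
  proof (intro free.span_sum free.span_base)
    fix b assume "b \<in> {..<length ds}"
    then have "lookup v b \<in> max_ideal" "single b 1 \<in> (F_carrier ds :: ('n, 'k) free set)"
      using assms(2) F_comp_carrier[OF basis_in_F_comp] by auto
    then show "fscale (lookup v b) (single b 1) \<in> {fscale p v |p v. p \<in> max_ideal \<and> v \<in> F_carrier ds}"
      by blast
  qed
  then show ?thesis
    using basis_expansion[OF v] by simp
qed

text \<open>
  The generators of \<open>F\<^bsub>i+1\<^esub>\<close> have larger degree than those of \<open>F\<^sub>i\<close>, so the coordinates of the image of a
  homogeneous element have positive degree, unless that element is zero.
\<close>

lemma linear_resolution_map_minimal:
  assumes "graded_hom (linear_degrees d r (Suc i)) (linear_degrees d r i) \<phi>"
    and v: "v \<in> F_comp (linear_degrees d r (Suc i)) j"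
  shows "\<phi> v \<in> mF (linear_degrees d r i)"
proof (cases "j - d - int i \<ge> 1")
  case True
  have "\<phi> v \<in> F_comp (linear_degrees d r i) j"
    using assms by (rule graded_hom_comp)
  then show ?thesis
    by (intro mFI) (auto simp: F_comp_linear hom_vectors_def F_carrier_linear intro: S_comp_max_ideal[OF _ True])
next
  case False
  have "v = 0"
  proof (rule poly_mapping_eqI)
    fix k
    have "lookup v k \<in> S_comp (j - d - int (Suc i))"
      using v by (simp add: F_comp_linear hom_vectors_def)
    then have "lookup (lookup v k) m = 0" for m
      using S_compD[of "lookup v k" _ m] False by force
    then show "lookup v k = lookup 0 k"
      by (simp add: poly_mapping_eqI)
  qed
  then show ?thesis
    using module_hom.zero[OF graded_hom_lin[OF assms(1)]] kfree.subspace_0[OF subspace_mF] by simp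
qed

text \<open>
  The differentials of \<open>F \<otimes> \<kk>\<close> vanish, so that Tor is \<open>F\<^sub>i/\<mm>F\<^sub>i\<close>, which involves neither the ideal nor the maps.
\<close>

lemma tor_dim_linear:
  fixes M :: "('n::finite, 'k::field) mpoly set"
  assumes R: "graded_free_resolution M (linear_degrees d r) aug \<delta>"
  shows "tor_dim (linear_degrees d r) \<delta> i j =
    kfree.dim (F_comp (linear_degrees d r i) j :: ('n, 'k) free set) -
    kfree.dim (mF (linear_degrees d r i) \<inter> F_comp (linear_degrees d r i) j :: ('n, 'k) free set)"
proof -
  have hom: "graded_hom (linear_degrees d r (Suc i)) (linear_degrees d r i) (\<delta> i)" for i
    using R by (simp add: graded_free_resolution_def graded_hom_def)
  note min = linear_resolution_map_minimal[OF hom]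
  have "tor_cycles (linear_degrees d r) \<delta> i j = F_comp (linear_degrees d r i) j"
    by (cases i) (auto simp: tor_cycles_def min)
  moreover have "tor_boundaries (linear_degrees d r) \<delta> i j =
      mF (linear_degrees d r i) \<inter> F_comp (linear_degrees d r i) j" (is "?B = ?m")
  proof
    show "?B \<subseteq> ?m"
      using min graded_hom_comp[OF hom]
      by (auto simp: tor_boundaries_def intro: kfree.subspace_add[OF subspace_mF] F_comp_add)
    show "?m \<subseteq> ?B"
      using module_hom.zero[OF graded_hom_lin[OF hom]]
      by (force simp: tor_boundaries_def intro: exI[of _ 0])
  qed
  ultimately show ?thesis
    by (simp add: tor_dim_def)
qed

lemma betti_linear_resolution:
  fixes M N :: "('n::finite, 'k::field) mpoly set"
  assumes "linear_resolution M d r" and "linear_resolution N d r"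
  shows "betti M i j = betti N i j"
proof -
  have "betti L i j =
    kfree.dim (F_comp (linear_degrees d r i) j :: ('n, 'k) free set) -
    kfree.dim (mF (linear_degrees d r i) \<inter> F_comp (linear_degrees d r i) j :: ('n, 'k) free set)"
    if "linear_resolution L d r" for L :: "('n, 'k) mpoly set"
    using that unfolding linear_resolution_def by (metis betti_eq_tor_dim tor_dim_linear)
  with assms show ?thesis
    by simp
qed

lemma linear_resolution_UNIV:
  "linear_resolution (UNIV :: ('n::finite, 'k::field) mpoly set) 0 (\<lambda>i. if i = 0 then 1 else 0)"
  unfolding linear_resolution_def
proof (intro exI)
  define r :: "nat \<Rightarrow> nat" where "r i = (if i = 0 then 1 else 0)" for i
  have zero: "v = 0" if "v \<in> F_carrier (linear_degrees 0 r (Suc i))" for i and v :: "('n, 'k) free"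
    using that by (intro poly_mapping_eqI) (simp add: F_carrier_linear r_def)
  have zero': "v = 0" if "v \<in> F_carrier (linear_degrees 0 r 0)" "lookup v 0 = 0" for v :: "('n, 'k) free"
  proof (rule poly_mapping_eqI)
    show "lookup v k = lookup 0 k" for k
      using that by (cases k) (simp_all add: F_carrier_linear r_def)
  qed
  have "p \<in> (\<lambda>v. lookup v 0) ` F_carrier (linear_degrees 0 r 0)" for p :: "('n, 'k) mpoly"
    by (rule image_eqI[of _ _ "single 0 p"]) (simp_all add: F_carrier_linear r_def lookup_single)
  moreover have "0 \<in> (F_carrier (linear_degrees 0 r i) :: ('n, 'k) free set)" for i
    by (simp add: F_carrier_linear)
  moreover from this have "(\<lambda>_. 0 :: ('n, 'k) free) ` (F_carrier (linear_degrees 0 r i) :: ('n, 'k) free set) = {0}" for i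
    by blast
  moreover have "lookup v 0 \<in> S_comp j" if "v \<in> F_comp (linear_degrees 0 r 0) j" for j and v :: "('n, 'k) free"
    using that by (simp add: F_comp_linear hom_vectors_def)
  ultimately show "graded_free_resolution (UNIV :: ('n, 'k) mpoly set)
      (linear_degrees 0 (\<lambda>i. if i = 0 then 1 else 0)) (\<lambda>v. lookup v 0) (\<lambda>_ _. 0)"
    unfolding graded_free_resolution_def r_def[symmetric]
    by (auto simp: module_hom_iff module_fscale module_mpoly lookup_add lookup_fscale dest: zero zero')
qed

lemma monom_mult_eq_0:
  fixes p :: "('n, 'k::field) mpoly"
  assumes "single m 1 * p = 0"
  shows "p = 0"
proof (rule poly_mapping_eqI)
  fix a
  have "single m 1 * p = single m 1 * (\<Sum>b\<in>keys p. single b (lookup p b))"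
    by (simp flip: mpoly_expansion)
  also have "\<dots> = (\<Sum>b\<in>keys p. single (m + b) (lookup p b))"
    by (simp add: sum_distrib_left mult_single)
  also have "lookup \<dots> (m + a) = lookup p a"
    by (simp add: lookup_sum lookup_single when_def in_keys_iff)
  finally show "lookup p a = lookup 0 a"
    using assms by simp
qed

text \<open>
  Multiplication by a monomial is injective and shifts degrees, so it suffices to change the
  augmentation.
\<close>

lemma linear_resolution_monom_mult:
  fixes M :: "('n::finite, 'k::field) mpoly set"
  assumes "linear_resolution M d r"
  shows "linear_resolution ((*) (single m 1) ` M) (d + int (monom_degree m)) r"
proof -
  obtain aug \<delta> where R: "graded_free_resolution M (linear_degrees d r) aug \<delta>"
    using assms by (auto simp: linear_resolution_def)
  let ?d = "d + int (monom_degree m)"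
  have car: "F_carrier (linear_degrees ?d r i) = (F_carrier (linear_degrees d r i) :: ('n, 'k) free set)" for i
    by (auto simp: F_carrier_linear)
  have comp: "F_comp (linear_degrees ?d r i) j =
      (F_comp (linear_degrees d r i) (j - int (monom_degree m)) :: ('n, 'k) free set)" for i j
  proof -
    have "j - ?d - int i = j - int (monom_degree m) - d - int i" by simp
    then show ?thesis by (simp only: F_comp_linear)
  qed
  have "single m 1 * p \<in> S_comp j" if "p \<in> S_comp (j - int (monom_degree m))" for j and p :: "('n, 'k) mpoly"
    using S_comp_mult[OF S_comp_single[OF refl, of m 1] that] by simp
  moreover have "{v \<in> F_carrier (linear_degrees d r 0). single m 1 * aug v = 0} =
      {v \<in> F_carrier (linear_degrees d r 0). aug v = 0}"
    by (auto dest: monom_mult_eq_0)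
  moreover have "(\<lambda>v. single m 1 * aug v) ` V = (*) (single m 1) ` aug ` V" for V
    by auto
  moreover have "module_hom fscale (*) (\<lambda>v. single m 1 * aug v)"
    using R by (auto simp: graded_free_resolution_def module_hom_iff distrib_left mult.left_commute)
  ultimately have "graded_free_resolution ((*) (single m 1) ` M) (linear_degrees ?d r) (\<lambda>v. single m 1 * aug v) \<delta>"
    using R unfolding graded_free_resolution_def car comp by (simp add: image_subset_iff)
  then show ?thesis
    by (auto simp: linear_resolution_def)
qed

section \<open>The resolution of a sum of two ideals\<close>

text \<open>
  Direct sums of free modules are formed by concatenation of coordinates: \<open>join\<close> puts three vectors with
  \<open>p\<close>, \<open>q\<close> and \<open>r\<close> coordinates next to each other, and \<open>block\<close> extracts one of them.
\<close>

definition block :: "nat \<Rightarrow> nat \<Rightarrow> ('n, 'k::field) free \<Rightarrow> ('n, 'k) free" where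
  "block m n v = (\<Sum>k<n. single k (lookup v (m + k)))"

definition join ::
    "nat \<Rightarrow> nat \<Rightarrow> nat \<Rightarrow> ('n, 'k::field) free \<Rightarrow> ('n, 'k) free \<Rightarrow> ('n, 'k) free \<Rightarrow> ('n, 'k) free" where
  "join p q r x y z = (\<Sum>k<p. single k (lookup x k)) + (\<Sum>k<q. single (p + k) (lookup y k)) +
     (\<Sum>k<r. single (p + q + k) (lookup z k))"

lemma lookup_block: "lookup (block m n v) k = (if k < n then lookup v (m + k) else 0)"
  by (simp add: block_def lookup_sum lookup_single when_def)

lemma lookup_shifted_sum:
  fixes v :: "nat \<Rightarrow>\<^sub>0 'b::comm_monoid_add"
  shows "lookup (\<Sum>k<n. single (m + k) (lookup v k)) x = (if m \<le> x \<and> x < m + n then lookup v (x - m) else 0)"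
proof (cases "m \<le> x")
  case True
  define x' where "x' = x - m"
  have "x = m + x'"
    using True by (simp add: x'_def)
  then show ?thesis
    by (simp add: lookup_sum lookup_single when_def)
qed (simp add: lookup_sum lookup_single when_def)

lemma lookup_join:
  "lookup (join p q r x y z) k =
     (if k < p then lookup x k else if k < p + q then lookup y (k - p)
      else if k < p + q + r then lookup z (k - (p + q)) else 0)"
  using lookup_shifted_sum[of 0 x p k]
  by (auto simp: join_def lookup_add lookup_shifted_sum)

lemma block_lin: "module_hom fscale fscale (block m n)"
  by (auto simp: module_hom_iff module_fscale lookup_block lookup_add lookup_fscale intro!: poly_mapping_eqI)

lemma join_add: "join p q r (x + x') (y + y') (z + z') = join p q r x y z + join p q r x' y' z'"
  by (rule poly_mapping_eqI) (simp add: lookup_join lookup_add)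

lemma join_scale: "join p q r (fscale c x) (fscale c y) (fscale c z) = fscale c (join p q r x y z)"
  by (rule poly_mapping_eqI) (simp add: lookup_join lookup_fscale)

lemma block_hom: "v \<in> hom_vectors l e \<Longrightarrow> block m n v \<in> hom_vectors n e"
  by (auto simp: hom_vectors_def lookup_block)

lemma join_hom:
  "x \<in> hom_vectors p e \<Longrightarrow> y \<in> hom_vectors q e \<Longrightarrow> z \<in> hom_vectors r e \<Longrightarrow>
     join p q r x y z \<in> hom_vectors (p + q + r) e"
  by (auto simp: hom_vectors_def lookup_join)

lemma block_join:
  assumes "\<And>k. k \<ge> p \<Longrightarrow> lookup x k = 0" "\<And>k. k \<ge> q \<Longrightarrow> lookup y k = 0" "\<And>k. k \<ge> r \<Longrightarrow> lookup z k = 0"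
  shows "block 0 p (join p q r x y z) = x" "block p q (join p q r x y z) = y"
    "block (p + q) r (join p q r x y z) = z"
  using assms by (auto intro!: poly_mapping_eqI simp: lookup_block lookup_join)

lemma join_block:
  assumes "\<And>k. k \<ge> p + q + r \<Longrightarrow> lookup v k = 0"
  shows "join p q r (block 0 p v) (block p q v) (block (p + q) r v) = v"
  using assms by (auto intro!: poly_mapping_eqI simp: lookup_block lookup_join)

text \<open>
  The exact sequence \<open>0 \<rightarrow> A \<inter> B \<rightarrow> A \<oplus> B \<rightarrow> A + B \<rightarrow> 0\<close> gives a resolution of \<open>A + B\<close>, namely the mapping
  cone of a lift of the first map to the resolutions. Its \<open>i\<close>-th module is \<open>A\<^sub>i \<oplus> B\<^sub>i \<oplus> C\<^bsub>i-1\<^esub>\<close>, where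
  \<open>C\<close> is the resolution of the intersection. The shift by one position agrees with the shift of the
  generating degree of \<open>A \<inter> B\<close>, which keeps the cone linear.
\<close>

lemma linear_resolution_sum:
  fixes A B :: "('n::finite, 'k::field) mpoly set"
  assumes "linear_resolution A d a" and "linear_resolution B d b"
    and "linear_resolution (A \<inter> B) (d + 1) c"
  shows "linear_resolution {x + y | x y. x \<in> A \<and> y \<in> B} d
    (\<lambda>i. a i + b i + (case i of 0 \<Rightarrow> 0 | Suc i' \<Rightarrow> c i'))"
proof -
  obtain augA \<delta>A where RA: "graded_free_resolution A (linear_degrees d a) augA \<delta>A"
    using assms(1) by (auto simp: linear_resolution_def)
  obtain augB \<delta>B where RB: "graded_free_resolution B (linear_degrees d b) augB \<delta>B"
    using assms(2) by (auto simp: linear_resolution_def)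
  obtain augC \<delta>C where RC: "graded_free_resolution (A \<inter> B) (linear_degrees (d + 1) c) augC \<delta>C"
    using assms(3) by (auto simp: linear_resolution_def)
  define V where "V n = {v :: ('n, 'k) free. \<forall>k\<ge>n. lookup v k = 0}" for n
  have car: "F_carrier (linear_degrees e r i) = V (r i)" for e r i
    by (auto simp: V_def F_carrier_linear)
  have augA: "module_hom fscale (*) augA" "\<And>v j. v \<in> hom_vectors (a 0) (j - d) \<Longrightarrow> augA v \<in> S_comp j"
      "augA ` V (a 0) = A" "\<And>v. v \<in> V (a 0) \<Longrightarrow> augA v = 0 \<Longrightarrow> v \<in> \<delta>A 0 ` V (a 1)"
      "\<And>v. v \<in> V (a 1) \<Longrightarrow> augA (\<delta>A 0 v) = 0"
    using RA unfolding graded_free_resolution_def car F_comp_linear by auto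
  have augB: "module_hom fscale (*) augB" "\<And>v j. v \<in> hom_vectors (b 0) (j - d) \<Longrightarrow> augB v \<in> S_comp j"
      "augB ` V (b 0) = B" "\<And>v. v \<in> V (b 0) \<Longrightarrow> augB v = 0 \<Longrightarrow> v \<in> \<delta>B 0 ` V (b 1)"
      "\<And>v. v \<in> V (b 1) \<Longrightarrow> augB (\<delta>B 0 v) = 0"
    using RB unfolding graded_free_resolution_def car F_comp_linear by auto
  have augC: "augC ` V (c 0) = A \<inter> B" "\<And>v. v \<in> V (c 0) \<Longrightarrow> augC v = 0 \<Longrightarrow> v \<in> \<delta>C 0 ` V (c 1)"
    using RC unfolding graded_free_resolution_def car by auto
  have \<delta>A: "graded_hom (linear_degrees d a (Suc i)) (linear_degrees d a i) (\<delta>A i)"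
      "\<And>v. v \<in> V (a (Suc i)) \<Longrightarrow> \<delta>A i v = 0 \<Longrightarrow> v \<in> \<delta>A (Suc i) ` V (a (Suc (Suc i)))"
      "\<And>v. v \<in> V (a (Suc (Suc i))) \<Longrightarrow> \<delta>A i (\<delta>A (Suc i) v) = 0" for i
    using exact_complex_hom[OF resolution_complex[OF RA], of "Suc i"]
      exact_complex_exact[OF resolution_complex[OF RA], of _ "Suc i"]
      exact_complex_square[OF resolution_complex[OF RA], of _ "Suc i"] by (simp_all add: car)
  have \<delta>B: "graded_hom (linear_degrees d b (Suc i)) (linear_degrees d b i) (\<delta>B i)"
      "\<And>v. v \<in> V (b (Suc i)) \<Longrightarrow> \<delta>B i v = 0 \<Longrightarrow> v \<in> \<delta>B (Suc i) ` V (b (Suc (Suc i)))"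
      "\<And>v. v \<in> V (b (Suc (Suc i))) \<Longrightarrow> \<delta>B i (\<delta>B (Suc i) v) = 0" for i
    using exact_complex_hom[OF resolution_complex[OF RB], of "Suc i"]
      exact_complex_exact[OF resolution_complex[OF RB], of _ "Suc i"]
      exact_complex_square[OF resolution_complex[OF RB], of _ "Suc i"] by (simp_all add: car)
  have \<delta>C: "graded_hom (linear_degrees (d + 1) c (Suc i)) (linear_degrees (d + 1) c i) (\<delta>C i)"
      "\<And>v. v \<in> V (c (Suc i)) \<Longrightarrow> \<delta>C i v = 0 \<Longrightarrow> v \<in> \<delta>C (Suc i) ` V (c (Suc (Suc i)))"
      "\<And>v. v \<in> V (c (Suc (Suc i))) \<Longrightarrow> \<delta>C i (\<delta>C (Suc i) v) = 0" for i
    using exact_complex_hom[OF resolution_complex[OF RC], of "Suc i"]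
      exact_complex_exact[OF resolution_complex[OF RC], of _ "Suc i"]
      exact_complex_square[OF resolution_complex[OF RC], of _ "Suc i"] by (simp_all add: car)
  obtain \<alpha> where \<alpha>: "\<And>i. graded_hom (linear_degrees (d + 1) c i) (linear_degrees d a i) (\<alpha> i)"
      "\<And>i v. v \<in> V (c (Suc i)) \<Longrightarrow> \<delta>A i (\<alpha> (Suc i) v) = \<alpha> i (\<delta>C i v)"
      "\<And>v. v \<in> V (c 0) \<Longrightarrow> augA (\<alpha> 0 v) = augC v"
    by (rule resolution_comparison[OF RC RA Int_lower1, unfolded car]) (rule that, assumption+)
  obtain \<beta> where \<beta>: "\<And>i. graded_hom (linear_degrees (d + 1) c i) (linear_degrees d b i) (\<beta> i)"
      "\<And>i v. v \<in> V (c (Suc i)) \<Longrightarrow> \<delta>B i (\<beta> (Suc i) v) = \<beta> i (\<delta>C i v)"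
      "\<And>v. v \<in> V (c 0) \<Longrightarrow> augB (\<beta> 0 v) = augC v"
    by (rule resolution_comparison[OF RC RB Int_lower2, unfolded car]) (rule that, assumption+)
  define c' where "c' i = (case i of 0 \<Rightarrow> 0 | Suc i' \<Rightarrow> c i')" for i
  define \<gamma> where "\<gamma> i = (case i of 0 \<Rightarrow> (\<lambda>v. 0) | Suc i' \<Rightarrow> \<delta>C i')" for i
  define t where "t i = a i + b i + c' i" for i
  have c'_simps [simp]: "c' 0 = 0" "c' (Suc i) = c i" for i
    by (simp_all add: c'_def)
  \<comment> \<open>The three components of an element of the cone. In \<open>PC i\<close> the index is the position in the
    resolution \<open>C\<close>, so that \<open>PC i\<close> applies to elements of the cone in position \<open>i + 1\<close>.\<close>
  define PA where "PA i v = block 0 (a i) v" for i and v :: "('n, 'k) free"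
  define PB where "PB i v = block (a i) (b i) v" for i and v :: "('n, 'k) free"
  define PC where "PC i v = block (a (Suc i) + b (Suc i)) (c i) v" for i and v :: "('n, 'k) free"
  define aug where "aug v = augA (PA 0 v) + augB (PB 0 v)" for v
  \<comment> \<open>The sign of \<open>\<beta>\<close> comes from the map \<open>A \<inter> B \<rightarrow> A \<oplus> B\<close>, which sends \<open>x\<close> to \<open>(x, -x)\<close>.\<close>
  define \<delta> where "\<delta> i v = join (a i) (b i) (c' i) (\<delta>A i (PA (Suc i) v) + \<alpha> i (PC i v))
    (\<delta>B i (PB (Suc i) v) - \<beta> i (PC i v)) (- \<gamma> i (PC i v))" for i v
  note linA = module_hom.add[OF augA(1)] module_hom.scale[OF augA(1)] module_hom.diff[OF augA(1)]
      module_hom.neg[OF augA(1)] module_hom.zero[OF augA(1)]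
  note linB = module_hom.add[OF augB(1)] module_hom.scale[OF augB(1)] module_hom.diff[OF augB(1)]
      module_hom.neg[OF augB(1)] module_hom.zero[OF augB(1)]
  have lin\<gamma>: "module_hom fscale fscale (\<gamma> i)" for i
    using graded_hom_lin[OF \<delta>C(1)] graded_hom_lin[OF graded_hom_0] by (cases i) (auto simp: \<gamma>_def)
  have linP: "module_hom fscale fscale (PA i)" "module_hom fscale fscale (PB i)"
    "module_hom fscale fscale (PC i)" for i
    unfolding PA_def[abs_def] PB_def[abs_def] PC_def[abs_def] by (rule block_lin)+
  note homs = linP lin\<gamma> graded_hom_lin[OF \<delta>A(1)] graded_hom_lin[OF \<delta>B(1)] graded_hom_lin[OF \<delta>C(1)]
    graded_hom_lin[OF \<alpha>(1)] graded_hom_lin[OF \<beta>(1)]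
  note lin = homs[THEN module_hom.add] homs[THEN module_hom.scale] homs[THEN module_hom.diff]
    homs[THEN module_hom.neg] homs[THEN module_hom.zero]
  have carr: "\<phi> v \<in> V (r' i')"
    if "graded_hom (linear_degrees e r i) (linear_degrees e' r' i') \<phi>" "v \<in> V (r i)" for e r i e' r' i' \<phi> v
    using graded_hom_carrier[OF that(1), of v] that(2) unfolding car .
  have V_add: "v + w \<in> V n" and V_diff: "v - w \<in> V n" and V_neg: "- v \<in> V n"
    if "v \<in> V n" "w \<in> V n" for v w n
    using that by (simp_all add: V_def lookup_add lookup_minus)
  have V0: "0 \<in> V n" for n
    by (simp add: V_def)
  have PV: "PA i v \<in> V (a i)" "PB i v \<in> V (b i)" "PC i v \<in> V (c i)" for i v
    by (simp_all add: V_def PA_def PB_def PC_def lookup_block)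
  have \<gamma>V: "\<gamma> i v \<in> V (c' i)" if "v \<in> V (c i)" for i v
    using that carr[OF \<delta>C(1)] by (cases i) (auto simp: \<gamma>_def V0)
  have joinV: "join p q r x y z \<in> V (p + q + r)" for p q r and x y z :: "('n, 'k) free"
    by (simp add: V_def lookup_join)
  have joinV': "join (a (Suc i)) (b (Suc i)) (c i) x y z \<in> V (t (Suc i))" for i x y z
    using joinV by (simp add: t_def)
  have P_join: "PA (Suc i) (join (a (Suc i)) (b (Suc i)) (c i) x y z) = x"
      "PB (Suc i) (join (a (Suc i)) (b (Suc i)) (c i) x y z) = y"
      "PC i (join (a (Suc i)) (b (Suc i)) (c i) x y z) = z"
    if "x \<in> V (a (Suc i))" "y \<in> V (b (Suc i))" "z \<in> V (c i)" for i x y z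
    using that block_join[of "a (Suc i)" x "b (Suc i)" y "c i" z]
    by (simp_all add: V_def PA_def PB_def PC_def)
  have P_join0: "PA 0 (join (a 0) (b 0) 0 x y z) = x" "PB 0 (join (a 0) (b 0) 0 x y z) = y"
    if "x \<in> V (a 0)" "y \<in> V (b 0)" for x y z
    using that by (auto intro!: poly_mapping_eqI simp: V_def PA_def PB_def lookup_block lookup_join)
  have join_P: "join (a (Suc i)) (b (Suc i)) (c i) (PA (Suc i) v) (PB (Suc i) v) (PC i v) = v"
    if "v \<in> V (t (Suc i))" for i v
    using that join_block[of "a (Suc i)" "b (Suc i)" "c i" v] by (simp add: V_def t_def PA_def PB_def PC_def)
  have join_P0: "join (a 0) (b 0) 0 (PA 0 v) (PB 0 v) 0 = v" if "v \<in> V (t 0)" for v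
    using that by (auto intro!: poly_mapping_eqI simp: V_def t_def PA_def PB_def lookup_block lookup_join)
  have \<delta>_lin: "module_hom fscale fscale (\<delta> i)" for i
  proof -
    have "\<delta> i (v + w) = \<delta> i v + \<delta> i w" for v w
      unfolding \<delta>_def join_add[symmetric] by (simp add: lin algebra_simps)
    moreover have "\<delta> i (fscale s v) = fscale s (\<delta> i v)" for s v
      unfolding \<delta>_def join_scale[symmetric]
      by (simp add: lin free.scale_right_distrib free.scale_right_diff_distrib)
    ultimately show ?thesis
      by (simp add: module_hom_iff module_fscale)
  qed
  have \<delta>_comp: "\<delta> i v \<in> hom_vectors (t i) (j - d - int i)"
    if v: "v \<in> hom_vectors (t (Suc i)) (j - d - int (Suc i))" for i v j
  proof -
    have P: "PA (Suc i) v \<in> F_comp (linear_degrees d a (Suc i)) j"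
        "PB (Suc i) v \<in> F_comp (linear_degrees d b (Suc i)) j"
        "PC i v \<in> F_comp (linear_degrees (d + 1) c i) j"
      using block_hom[OF v] by (simp_all add: F_comp_linear PA_def PB_def PC_def algebra_simps)
    have "\<gamma> i (PC i v) \<in> hom_vectors (c' i) (j - d - int i)"
    proof (cases i)
      case 0
      then show ?thesis by (simp add: \<gamma>_def hom_vectors_def)
    next
      case (Suc i')
      then show ?thesis
        using graded_hom_comp[OF \<delta>C(1), of "PC i v" i' j] P(3)
        by (simp add: \<gamma>_def F_comp_linear algebra_simps)
    qed
    then have "- \<gamma> i (PC i v) \<in> hom_vectors (c' i) (j - d - int i)"
      by (simp add: hom_vectors_def S_comp_uminus)
    moreover have "\<delta>A i (PA (Suc i) v) + \<alpha> i (PC i v) \<in> hom_vectors (a i) (j - d - int i)"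
      using F_comp_add[OF graded_hom_comp[OF \<delta>A(1) P(1)] graded_hom_comp[OF \<alpha>(1) P(3)]]
      by (simp add: F_comp_linear)
    moreover have "\<delta>B i (PB (Suc i) v) - \<beta> i (PC i v) \<in> hom_vectors (b i) (j - d - int i)"
      using F_comp_diff[OF graded_hom_comp[OF \<delta>B(1) P(2)] graded_hom_comp[OF \<beta>(1) P(3)]]
      by (simp add: F_comp_linear)
    ultimately show ?thesis
      unfolding \<delta>_def t_def by (intro join_hom)
  qed
  have \<delta>_V: "\<delta> i v \<in> V (t i)" for i v
    unfolding \<delta>_def t_def by (rule joinV)
  have \<delta>P: "PA i (\<delta> i v) = \<delta>A i (PA (Suc i) v) + \<alpha> i (PC i v)"
      "PB i (\<delta> i v) = \<delta>B i (PB (Suc i) v) - \<beta> i (PC i v)" for i v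
  proof -
    have "\<delta>A i (PA (Suc i) v) + \<alpha> i (PC i v) \<in> V (a i)" "\<delta>B i (PB (Suc i) v) - \<beta> i (PC i v) \<in> V (b i)"
      by (intro V_add V_diff carr[OF \<delta>A(1)] carr[OF \<delta>B(1)] carr[OF \<alpha>(1)] carr[OF \<beta>(1)] PV)+
    moreover have "- \<gamma> i (PC i v) \<in> V (c' i)"
      using V_neg \<gamma>V PV(3) by blast
    ultimately show "PA i (\<delta> i v) = \<delta>A i (PA (Suc i) v) + \<alpha> i (PC i v)"
      "PB i (\<delta> i v) = \<delta>B i (PB (Suc i) v) - \<beta> i (PC i v)"
      by (cases i; simp add: \<delta>_def P_join P_join0)+
  qed
  have \<delta>PC: "PC i (\<delta> (Suc i) v) = - \<delta>C i (PC (Suc i) v)" for i v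
  proof -
    have "\<delta>A (Suc i) (PA (Suc (Suc i)) v) + \<alpha> (Suc i) (PC (Suc i) v) \<in> V (a (Suc i))"
      "\<delta>B (Suc i) (PB (Suc (Suc i)) v) - \<beta> (Suc i) (PC (Suc i) v) \<in> V (b (Suc i))"
      by (intro V_add V_diff carr[OF \<delta>A(1)] carr[OF \<delta>B(1)] carr[OF \<alpha>(1)] carr[OF \<beta>(1)] PV)+
    moreover have "- \<delta>C i (PC (Suc i) v) \<in> V (c i)"
      using V_neg carr[OF \<delta>C(1)] PV(3) by blast
    ultimately show ?thesis
      by (simp add: \<delta>_def P_join \<gamma>_def)
  qed
  have aug_\<delta>: "aug (\<delta> 0 v) = 0" for v
    using \<alpha>(3)[OF PV(3)[of 0 v]] \<beta>(3)[OF PV(3)[of 0 v]] augA(5) augB(5) PV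
    by (simp add: aug_def \<delta>P linA linB)
  have \<delta>_\<delta>: "\<delta> i (\<delta> (Suc i) v) = 0" for i v
  proof -
    have "\<gamma> i (\<delta>C i (PC (Suc i) v)) = 0"
      using \<delta>C(3) PV(3) by (cases i) (simp_all add: \<gamma>_def)
    moreover have "join p q r (0 :: ('n, 'k) free) 0 0 = 0" for p q r
      by (rule poly_mapping_eqI) (simp add: lookup_join)
    ultimately show ?thesis
      unfolding \<delta>_def[of i] \<delta>P \<delta>PC
      by (simp add: lin \<delta>A(3) \<delta>B(3) \<alpha>(2) \<beta>(2) PV)
  qed
  \<comment> \<open>Exactness of the cone: if the \<open>C\<close>-component of a cycle \<open>v\<close> is the boundary of \<open>x\<close>, then
    \<open>PA i v + \<alpha> i x\<close> and \<open>PB i v - \<beta> i x\<close> are cycles, and boundaries of these and \<open>-x\<close> give \<open>v\<close>.\<close>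
  have key: "v \<in> \<delta> i ` V (t (Suc i))"
    if "x \<in> V (c i)" and vA: "PA i v + \<alpha> i x \<in> \<delta>A i ` V (a (Suc i))"
      and vB: "PB i v - \<beta> i x \<in> \<delta>B i ` V (b (Suc i))"
      and vC: "\<And>i'. i = Suc i' \<Longrightarrow> PC i' v = \<delta>C i' x" and v: "v \<in> V (t i)" for i v x
  proof -
    obtain y where y: "y \<in> V (a (Suc i))" "\<delta>A i y = PA i v + \<alpha> i x"
      using vA by force
    obtain z where z: "z \<in> V (b (Suc i))" "\<delta>B i z = PB i v - \<beta> i x"
      using vB by force
    have x: "- x \<in> V (c i)"
      using V_neg that(1) by blast
    define w where "w = join (a (Suc i)) (b (Suc i)) (c i) y z (- x)"
    have w: "PA (Suc i) w = y" "PB (Suc i) w = z" "PC i w = - x"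
      unfolding w_def using P_join[OF y(1) z(1) x] by auto
    have "\<delta> i w = join (a i) (b i) (c' i) (PA i v) (PB i v) (\<gamma> i x)"
      by (simp add: \<delta>_def w y(2) z(2) lin)
    also have "\<dots> = v"
    proof (cases i)
      case 0
      then show ?thesis using join_P0 v by (simp add: \<gamma>_def)
    next
      case (Suc i')
      then show ?thesis using join_P[of v i'] v vC by (simp add: \<gamma>_def)
    qed
    finally have "\<delta> i w = v" .
    moreover have "w \<in> V (t (Suc i))"
      unfolding w_def by (rule joinV')
    ultimately show ?thesis by blast
  qed
  have "graded_free_resolution {x + y | x y. x \<in> A \<and> y \<in> B} (linear_degrees d t) aug \<delta>"
    unfolding graded_free_resolution_def car F_comp_linear
  proof (intro conjI allI)
    show "module_hom fscale (*) aug"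
      by (simp add: module_hom_iff module_fscale module_mpoly aug_def lin linA linB algebra_simps)
    show "aug ` hom_vectors (t 0) (j - d - int 0) \<subseteq> S_comp j" for j
      unfolding aug_def PA_def PB_def by (auto intro!: S_comp_add augA(2) augB(2) block_hom)
    show "module_hom fscale fscale (\<delta> i)" for i
      by (rule \<delta>_lin)
    show "\<delta> i ` hom_vectors (t (Suc i)) (j - d - int (Suc i)) \<subseteq> hom_vectors (t i) (j - d - int i)" for i j
      using \<delta>_comp by blast
    show "aug ` V (t 0) = {x + y | x y. x \<in> A \<and> y \<in> B}"
    proof
      show "aug ` V (t 0) \<subseteq> {x + y | x y. x \<in> A \<and> y \<in> B}"
      proof clarify
        fix v assume "v \<in> V (t 0)"
        have "augA (PA 0 v) \<in> A" "augB (PB 0 v) \<in> B"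
          using augA(3) augB(3) PV(1,2) by (metis image_eqI)+
        then show "\<exists>x y. aug v = x + y \<and> x \<in> A \<and> y \<in> B"
          unfolding aug_def by blast
      qed
      show "{x + y | x y. x \<in> A \<and> y \<in> B} \<subseteq> aug ` V (t 0)"
      proof clarify
        fix x y assume "x \<in> A" "y \<in> B"
        then obtain x' y' where x': "x' \<in> V (a 0)" "augA x' = x" and y': "y' \<in> V (b 0)" "augB y' = y"
          using augA(3) augB(3) by blast
        have "aug (join (a 0) (b 0) 0 x' y' 0) = x + y"
          by (simp add: aug_def P_join0 x' y')
        moreover have "join (a 0) (b 0) 0 x' y' 0 \<in> V (t 0)"
          using joinV[of "a 0" "b 0" 0] by (simp add: t_def)
        ultimately show "x + y \<in> aug ` V (t 0)"
          by (metis image_eqI)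
      qed
    qed
    show "{v \<in> V (t 0). aug v = 0} = \<delta> 0 ` V (t 1)"
    proof
      show "\<delta> 0 ` V (t 1) \<subseteq> {v \<in> V (t 0). aug v = 0}"
        using \<delta>_V aug_\<delta> by blast
      show "{v \<in> V (t 0). aug v = 0} \<subseteq> \<delta> 0 ` V (t 1)"
      proof clarify
        fix v assume v: "v \<in> V (t 0)" "aug v = 0"
        have eq: "augA (PA 0 v) = - augB (PB 0 v)"
          using v(2) by (simp add: aug_def eq_neg_iff_add_eq_0)
        then have eq': "augA (PA 0 v) = augB (- PB 0 v)"
          by (simp add: linB)
        have "augA (PA 0 v) \<in> A \<inter> B"
          using augA(3) augB(3) PV(1)[of 0 v] V_neg[OF PV(2)[of 0 v] PV(2)] eq' by (metis IntI image_eqI)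
        then have "- augA (PA 0 v) \<in> A \<inter> B"
          using augA(3) augB(3) V_neg[OF PV(1)[of 0 v] PV(1)] PV(2)[of 0 v] eq
          by (metis IntI image_eqI linA(4) minus_minus)
        then obtain x where x: "x \<in> V (c 0)" "augC x = - augA (PA 0 v)"
          using augC(1) by (metis imageE)
        have "PA 0 v + \<alpha> 0 x \<in> \<delta>A 0 ` V (a 1)"
          by (intro augA(4) V_add PV carr[OF \<alpha>(1)] x(1)) (simp add: linA \<alpha>(3) x)
        moreover have "PB 0 v - \<beta> 0 x \<in> \<delta>B 0 ` V (b 1)"
          by (intro augB(4) V_diff PV carr[OF \<beta>(1)] x(1)) (simp add: linB \<beta>(3) x eq)
        ultimately show "v \<in> \<delta> 0 ` V (t 1)"
          using key[of x 0 v] x(1) v(1) by simp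
      qed
    qed
    show "{v \<in> V (t (Suc i)). \<delta> i v = 0} = \<delta> (Suc i) ` V (t (Suc (Suc i)))" for i
    proof
      show "\<delta> (Suc i) ` V (t (Suc (Suc i))) \<subseteq> {v \<in> V (t (Suc i)). \<delta> i v = 0}"
        using \<delta>_V \<delta>_\<delta> by blast
      show "{v \<in> V (t (Suc i)). \<delta> i v = 0} \<subseteq> \<delta> (Suc i) ` V (t (Suc (Suc i)))"
      proof clarify
        fix v assume v: "v \<in> V (t (Suc i))" "\<delta> i v = 0"
        let ?x = "PC i v"
        have eA: "\<delta>A i (PA (Suc i) v) + \<alpha> i ?x = 0" and eB: "\<delta>B i (PB (Suc i) v) - \<beta> i ?x = 0"
          using \<delta>P[of i v] v(2) by (simp_all add: lin)
        have "?x \<in> \<delta>C i ` V (c (Suc i))"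
        proof (cases i)
          \<comment> \<open>Here \<open>\<gamma> 0 = 0\<close> gives no information; that \<open>?x\<close> is a cycle follows from the first component.\<close>
          case 0
          have "augC ?x = augA (\<alpha> 0 ?x)"
            using \<alpha>(3) PV(3) 0 by simp
          also have "\<dots> = - augA (\<delta>A 0 (PA (Suc 0) v))"
            using eA 0 by (metis add.commute add_eq_0_iff linA(4))
          also have "\<dots> = 0"
            using augA(5) PV(1) by simp
          finally show ?thesis
            using augC(2) PV(3) 0 by simp
        next
          case (Suc i')
          then show ?thesis
            using \<delta>PC[of i' v] v(2) \<delta>C(2) PV(3) by (simp add: lin)
        qed
        then obtain x where x: "x \<in> V (c (Suc i))" "?x = \<delta>C i x"
          by blast
        have "PA (Suc i) v + \<alpha> (Suc i) x \<in> \<delta>A (Suc i) ` V (a (Suc (Suc i)))"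
          by (intro \<delta>A(2) V_add PV carr[OF \<alpha>(1)] x(1)) (use eA x in \<open>simp add: lin \<alpha>(2)\<close>)
        moreover have "PB (Suc i) v - \<beta> (Suc i) x \<in> \<delta>B (Suc i) ` V (b (Suc (Suc i)))"
          by (intro \<delta>B(2) V_diff PV carr[OF \<beta>(1)] x(1)) (use eB x in \<open>simp add: lin \<beta>(2)\<close>)
        ultimately show "v \<in> \<delta> (Suc i) ` V (t (Suc (Suc i)))"
          using key[of x "Suc i" v] x v(1) by simp
      qed
    qed
  qed
  then show ?thesis
    unfolding linear_resolution_def t_def c'_def by blast
qed

section \<open>Monomial ideals\<close>

text \<open>
  A monomial ideal is handled through the set of exponents of its monomials. Sums, intersections and
  multiplication by a monomial then become operations on sets of exponents. The ideal property is
  equivalent to \<open>up_closed\<close>.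
\<close>

definition mono_ideal :: "('n \<Rightarrow>\<^sub>0 nat) set \<Rightarrow> ('n, 'k::field) mpoly set" where
  "mono_ideal U = {p. keys p \<subseteq> U}"

definition up_closed :: "('n \<Rightarrow>\<^sub>0 nat) set \<Rightarrow> bool" where
  "up_closed U \<longleftrightarrow> (\<forall>a\<in>U. \<forall>b. a + b \<in> U)"

lemma keys_monom_mult:
  "keys (single m 1 * p) \<subseteq> (+) m ` keys p"
  using keys_mult[of "single m 1" p] by (auto split: if_splits)

lemma subspace_mono_ideal:
  assumes "up_closed U"
  shows "mpoly.subspace (mono_ideal U :: ('n, 'k::field) mpoly set)"
proof (rule mpoly.subspaceI)
  fix p q :: "('n, 'k) mpoly"
  show "p + q \<in> mono_ideal U" if "p \<in> mono_ideal U" "q \<in> mono_ideal U"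
    using that keys_add[of p q] by (auto simp: mono_ideal_def)
  show "q * p \<in> mono_ideal U" if "p \<in> mono_ideal U"
  proof -
    have "a + b \<in> U" if "a \<in> keys q" "b \<in> keys p" for a b
      using that \<open>p \<in> mono_ideal U\<close> assms unfolding mono_ideal_def up_closed_def
      by (metis add.commute mem_Collect_eq subsetD)
    then show ?thesis
      using keys_mult[of q p] by (auto simp: mono_ideal_def)
  qed
qed (simp add: mono_ideal_def)

lemma single_in_mono_ideal: "m \<in> U \<Longrightarrow> single m c \<in> mono_ideal U"
  by (simp add: mono_ideal_def)

lemma mono_ideal_subset:
  fixes I :: "('n, 'k::field) mpoly set"
  assumes "mpoly.subspace I" and "\<And>m. m \<in> U \<Longrightarrow> single m 1 \<in> I"
  shows "mono_ideal U \<subseteq> I"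
proof
  fix p :: "('n, 'k) mpoly" assume "p \<in> mono_ideal U"
  then have "single m (lookup p m) \<in> I" if "m \<in> keys p" for m
    using mpoly.subspace_scale[OF assms(1) assms(2), of m "single 0 (lookup p m)"] that
    by (auto simp: mult_single mono_ideal_def)
  then have "(\<Sum>m\<in>keys p. single m (lookup p m)) \<in> I"
    by (rule mpoly.subspace_sum[OF assms(1)])
  then show "p \<in> I"
    using mpoly_expansion[of p] by simp
qed

lemma mono_ideal_UNIV: "mono_ideal UNIV = UNIV"
  by (simp add: mono_ideal_def)

lemma mono_ideal_Int: "mono_ideal (U \<inter> V) = mono_ideal U \<inter> mono_ideal V"
  by (auto simp: mono_ideal_def)

lemma mono_ideal_Un:
  "mono_ideal (U \<union> V) = {p + q | p q. p \<in> mono_ideal U \<and> q \<in> (mono_ideal V :: ('n, 'k::field) mpoly set)}"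
  (is "?L = ?R")
proof
  show "?L \<subseteq> ?R"
  proof
    fix p :: "('n, 'k) mpoly" assume p: "p \<in> mono_ideal (U \<union> V)"
    define q where "q = (\<Sum>m\<in>keys p \<inter> U. single m (lookup p m))"
    have q: "lookup q m = (if m \<in> U then lookup p m else 0)" for m
      by (simp add: q_def lookup_sum lookup_single when_def in_keys_iff)
    have "q \<in> mono_ideal U"
      by (auto simp: mono_ideal_def in_keys_iff q split: if_splits)
    moreover have "p - q \<in> mono_ideal V"
      using p by (auto simp: mono_ideal_def in_keys_iff q lookup_minus split: if_splits)
    moreover have "p = q + (p - q)"
      by simp
    ultimately show "p \<in> ?R"
      by blast
  qed
  show "?R \<subseteq> ?L"
    by (auto simp: mono_ideal_def dest!: subsetD[OF keys_add])
qed

lemma mono_ideal_shift: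
  "mono_ideal ((+) m ` U) = (*) (single m 1) ` (mono_ideal U :: ('n, 'k::field) mpoly set)" (is "?L = ?R")
proof
  show "?R \<subseteq> ?L"
    by (auto simp: mono_ideal_def dest!: subsetD[OF keys_monom_mult])
  show "?L \<subseteq> ?R"
  proof
    fix p :: "('n, 'k) mpoly" assume p: "p \<in> mono_ideal ((+) m ` U)"
    define q where "q = (\<Sum>a\<in>keys p. single (a - m) (lookup p a))"
    have mem: "m + (a - m) = a \<and> a - m \<in> U" if "a \<in> keys p" for a
    proof -
      from that p obtain b where "b \<in> U" "a = m + b"
        by (auto simp: mono_ideal_def)
      then show ?thesis by simp
    qed
    have "single m 1 * q = (\<Sum>a\<in>keys p. single a (lookup p a))"
      unfolding q_def sum_distrib_left by (rule sum.cong) (simp_all add: mult_single mem)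
    then have "p = single m 1 * q"
      using mpoly_expansion[of p] by simp
    moreover have "q \<in> mono_ideal U"
      unfolding mono_ideal_def q_def using keys_sum[of "\<lambda>a. single (a - m) (lookup p a)" "keys p"] mem
      by (fastforce split: if_splits)
    ultimately show "p \<in> ?R"
      by blast
  qed
qed

lemma ideal_gen_monomials:
  "ideal_gen ((\<lambda>m. single m 1) ` G) =
     (mono_ideal {m + b | m b. m \<in> G} :: ('n, 'k::field) mpoly set)" (is "?I = mono_ideal ?U")
proof
  have "up_closed ?U"
    unfolding up_closed_def by clarify (metis add.assoc)
  then show "?I \<subseteq> mono_ideal ?U"
    by (intro mpoly.span_minimal subspace_mono_ideal)
      (auto intro!: single_in_mono_ideal, metis add_0_right)
  have "single (m + b) 1 \<in> ?I" if "m \<in> G" for m b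
    using mpoly.span_scale[OF mpoly.span_base, of "single m 1" "(\<lambda>m. single m 1) ` G" "single b 1"] that
    by (simp add: mult_single add.commute)
  then show "mono_ideal ?U \<subseteq> ?I"
    by (intro mono_ideal_subset) auto
qed

lemma ideal_mult_mono_ideal:
  assumes "up_closed V"
  shows "ideal_mult (mono_ideal U) (mono_ideal V) =
    (mono_ideal {u + v | u v. u \<in> U \<and> v \<in> V} :: ('n, 'k::field) mpoly set)"
    (is "?I = mono_ideal ?W")
proof
  have "up_closed ?W"
    using assms unfolding up_closed_def by clarify (metis add.assoc)
  moreover have "p * q \<in> mono_ideal ?W" if "p \<in> mono_ideal U" "q \<in> mono_ideal V" for p q :: "('n, 'k) mpoly"
    using keys_mult[of p q] that by (fastforce simp: mono_ideal_def)
  ultimately show "?I \<subseteq> mono_ideal ?W"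
    unfolding ideal_mult_def by (intro mpoly.span_minimal subspace_mono_ideal) auto
  have "single (u + v) 1 \<in> ?I" if "u \<in> U" "v \<in> V" for u v
  proof -
    have "single u 1 * single v 1 \<in> ?I"
      unfolding ideal_mult_def using that
      by (intro mpoly.span_base CollectI exI[of _ "single u 1"] exI[of _ "single v 1"]) (auto intro: single_in_mono_ideal)
    then show ?thesis
      by (simp add: mult_single)
  qed
  then show "mono_ideal ?W \<subseteq> ?I"
    by (intro mono_ideal_subset) (auto simp: ideal_mult_def)
qed

section \<open>Powers of the ideal of a tree\<close>

text \<open>
  The trees with at least two vertices, in the form that supports induction over leaves. The vertex set is
  explicit, because the trees that occur in the induction have fewer vertices than the ring has variables.
\<close>

inductive leaf_tree :: "'n set \<Rightarrow> 'n graph \<Rightarrow> bool" where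
  edge: "u \<noteq> w \<Longrightarrow> leaf_tree {u, w} {{u, w}}"
| leaf: "leaf_tree V E \<Longrightarrow> u \<in> V \<Longrightarrow> v \<notin> V \<Longrightarrow> leaf_tree (insert v V) (insert {u, v} E)"

lemma leaf_tree_edge_subset: "leaf_tree V E \<Longrightarrow> e \<in> E \<Longrightarrow> e \<subseteq> V"
  by (induction rule: leaf_tree.induct) auto

lemma leaf_tree_incident: "leaf_tree V E \<Longrightarrow> u \<in> V \<Longrightarrow> \<exists>e\<in>E. u \<in> e"
  by (induction rule: leaf_tree.induct) auto

lemma leaf_tree_card: "leaf_tree (V :: 'n::finite set) E \<Longrightarrow> card V \<ge> 2"
  by (induction rule: leaf_tree.induct) (auto simp: card_insert_if)

definition sqfree :: "'n::finite set \<Rightarrow> 'n \<Rightarrow>\<^sub>0 nat" where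
  "sqfree A = (\<Sum>i\<in>A. single i 1)"

lemma lookup_sqfree: "lookup (sqfree A) i = (if i \<in> A then 1 else 0)"
  by (simp add: sqfree_def lookup_sum lookup_single when_def)

lemma monom_degree_sqfree: "monom_degree (sqfree A) = card A"
  by (simp add: monom_degree_def lookup_sqfree flip: sum.inter_filter)

lemma sqfree_empty [simp]: "sqfree {} = 0"
  by (simp add: sqfree_def)

text \<open>
  The exponents of the monomials in the \<open>s\<close>-th power of the ideal generated by the \<open>X\<^bsub>V - e\<^esub>\<close>, \<open>e \<in> E\<close>.
\<close>

primrec power_exps :: "'n::finite set \<Rightarrow> 'n graph \<Rightarrow> nat \<Rightarrow> ('n \<Rightarrow>\<^sub>0 nat) set" where
  "power_exps V E 0 = UNIV"
| "power_exps V E (Suc s) = {sqfree (V - e) + b | e b. e \<in> E \<and> b \<in> power_exps V E s}"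

lemma power_exps_add: "a \<in> power_exps V E s \<Longrightarrow> a + b \<in> power_exps V E s"
proof (induction s arbitrary: a)
  case (Suc s)
  then show ?case
    by simp (metis add.assoc)
qed simp

lemma up_closed_power_exps: "up_closed (power_exps V E s)"
  by (simp add: up_closed_def power_exps_add)

lemma power_exps_sqfree_mono:
  assumes "b \<in> power_exps V E s" and "e \<in> E" and "V - e \<subseteq> A"
  shows "sqfree A + b \<in> power_exps V E (Suc s)"
proof -
  have "sqfree A = sqfree (V - e) + sqfree (A - (V - e))"
    using assms(3) by (intro poly_mapping_eqI) (auto simp: lookup_add lookup_sqfree)
  then have "sqfree A + b = sqfree (V - e) + (b + sqfree (A - (V - e)))"
    by (simp add: ac_simps)
  moreover have "b + sqfree (A - (V - e)) \<in> power_exps V E s"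
    using assms(1) by (rule power_exps_add)
  ultimately show ?thesis
    using assms(2) by auto
qed

text \<open>
  Since no generator involves a variable outside \<open>V\<close>, membership does not depend on the exponents of such
  variables.
\<close>

lemma power_exps_ignore:
  assumes "v \<notin> V" and "a \<in> power_exps V E s" and "\<And>i. i \<noteq> v \<Longrightarrow> lookup a' i = lookup a i"
  shows "a' \<in> power_exps V E s"
  using assms(2,3)
proof (induction s arbitrary: a a')
  case (Suc s)
  then obtain e b where e: "e \<in> E" and b: "b \<in> power_exps V E s" and a: "a = sqfree (V - e) + b"
    by auto
  define b' where "b' = a' - sqfree (V - e)"
  have "lookup b' i = lookup b i" if "i \<noteq> v" for i
    using Suc.prems(2)[OF that] by (simp add: b'_def a lookup_add lookup_minus)
  then have "b' \<in> power_exps V E s"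
    using Suc.IH[OF b] by blast
  moreover have "a' = sqfree (V - e) + b'"
  proof (rule poly_mapping_eqI)
    fix i
    show "lookup a' i = lookup (sqfree (V - e) + b') i"
      using Suc.prems(2)[of i] assms(1)
      by (cases "i = v") (auto simp: b'_def a lookup_add lookup_minus lookup_sqfree)
  qed
  ultimately show ?case
    using e by auto
qed simp

context
  fixes V :: "'n::finite set" and E u v
  assumes tree: "leaf_tree V E" and u: "u \<in> V" and v: "v \<notin> V"
begin

lemma leaf_edge_monomials:
  shows "sqfree (insert v V - {u, v}) = sqfree (V - {u})"
    and "e \<in> E \<Longrightarrow> sqfree (insert v V - e) = single v 1 + sqfree (V - e)"
proof -
  show "sqfree (insert v V - {u, v}) = sqfree (V - {u})"
    using v by (intro arg_cong[of _ _ sqfree]) auto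
  show "sqfree (insert v V - e) = single v 1 + sqfree (V - e)" if "e \<in> E"
    using v leaf_tree_edge_subset[OF tree that]
    by (intro poly_mapping_eqI) (auto simp: lookup_add lookup_sqfree lookup_single when_def)
qed

text \<open>
  Every generator of the ideal of the larger tree is a multiple of a generator of the ideal of the smaller
  one. For the new edge this holds because \<open>u\<close> also lies on an edge of the smaller tree.
\<close>

lemma power_exps_leaf_subset: "a \<in> power_exps (insert v V) (insert {u, v} E) s \<Longrightarrow> a \<in> power_exps V E s"
proof (induction s arbitrary: a)
  case (Suc s)
  then obtain e b where e: "e \<in> insert {u, v} E" and b: "b \<in> power_exps V E s" and a: "a = sqfree (insert v V - e) + b"
    by auto
  obtain e0 where e0: "e0 \<in> E" "u \<in> e0"
    using leaf_tree_incident[OF tree u] by blast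
  have "\<exists>e1\<in>E. V - e1 \<subseteq> insert v V - e"
    using e e0 v by (cases "e = {u, v}") auto
  then show ?case
    using a b power_exps_sqfree_mono by blast
qed simp

lemma power_exps_leaf_shift: "a \<in> power_exps V E s \<Longrightarrow> single v s + a \<in> power_exps (insert v V) (insert {u, v} E) s"
proof (induction s arbitrary: a)
  case (Suc s)
  then obtain e b where e: "e \<in> E" and b: "b \<in> power_exps V E s" and a: "a = sqfree (V - e) + b"
    by auto
  have "single v (Suc s) = single v 1 + single v s"
    by (simp flip: single_add)
  then have "single v (Suc s) + a = sqfree (insert v V - e) + (single v s + b)"
    by (simp add: a leaf_edge_monomials(2)[OF e] ac_simps)
  then show ?case
    using e Suc.IH[OF b] by auto
qed simp

text \<open>
  A product of \<open>s + 1\<close> generators either contains the generator of the new edge, or all its factors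
  are divisible by the variable of the leaf.
\<close>

lemma power_exps_leaf:
  "power_exps (insert v V) (insert {u, v} E) (Suc s) =
     (+) (single v (Suc s)) ` power_exps V E (Suc s) \<union> (+) (sqfree (V - {u})) ` power_exps (insert v V) (insert {u, v} E) s"
    (is "_ = ?A s \<union> ?B s")
proof
  show "?A s \<union> ?B s \<subseteq> power_exps (insert v V) (insert {u, v} E) (Suc s)"
  proof (intro Un_least image_subsetI)
    show "single v (Suc s) + a \<in> power_exps (insert v V) (insert {u, v} E) (Suc s)" if "a \<in> power_exps V E (Suc s)" for a
      using that by (rule power_exps_leaf_shift)
    show "sqfree (V - {u}) + a \<in> power_exps (insert v V) (insert {u, v} E) (Suc s)" if "a \<in> power_exps (insert v V) (insert {u, v} E) s" for a
      using that leaf_edge_monomials(1) by (simp, metis insertI1)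
  qed
  show "power_exps (insert v V) (insert {u, v} E) (Suc s) \<subseteq> ?A s \<union> ?B s"
  proof (induction s)
    case 0
    show ?case
    proof
      fix a assume "a \<in> power_exps (insert v V) (insert {u, v} E) (Suc 0)"
      then obtain e b where e: "e \<in> insert {u, v} E" and a: "a = sqfree (insert v V - e) + b"
        by auto
      show "a \<in> ?A 0 \<union> ?B 0"
      proof (cases "e = {u, v}")
        case True
        then show ?thesis
          using a leaf_edge_monomials(1) by simp
      next
        case False
        then have "a = single v (Suc 0) + (sqfree (V - e) + b)" and "e \<in> E"
          using a e leaf_edge_monomials(2)[of e] by (simp_all add: ac_simps)
        moreover from this have "sqfree (V - e) + b \<in> power_exps V E (Suc 0)"
          by auto
        ultimately show ?thesis by blast
      qed
    qed
  next
    case (Suc s)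
    show ?case
    proof
      fix a assume "a \<in> power_exps (insert v V) (insert {u, v} E) (Suc (Suc s))"
      then obtain e b where e: "e \<in> insert {u, v} E" and b: "b \<in> power_exps (insert v V) (insert {u, v} E) (Suc s)"
          and a: "a = sqfree (insert v V - e) + b"
        by (auto simp only: power_exps.simps)
      show "a \<in> ?A (Suc s) \<union> ?B (Suc s)"
      proof (cases "e = {u, v}")
        case True
        then show ?thesis
          using b a leaf_edge_monomials(1) by simp
      next
        case False
        then have eE: "e \<in> E" using e by blast
        consider c where "c \<in> power_exps V E (Suc s)" "b = single v (Suc s) + c"
          | c where "c \<in> power_exps (insert v V) (insert {u, v} E) s" "b = sqfree (V - {u}) + c"
          using subsetD[OF Suc.IH b] by auto
        then show ?thesis
        proof cases
          case 1
          have "single v (Suc (Suc s)) = single v 1 + single v (Suc s)"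
            by (simp flip: single_add)
          then have "a = single v (Suc (Suc s)) + (sqfree (V - e) + c)"
            by (simp add: a leaf_edge_monomials(2)[OF eE] 1(2) ac_simps)
          moreover have "sqfree (V - e) + c \<in> power_exps V E (Suc (Suc s))"
            using eE 1(1) by (auto simp only: power_exps.simps)
          ultimately show ?thesis by blast
        next
          case 2
          have "a = sqfree (V - {u}) + (sqfree (insert v V - e) + c)"
            by (simp add: a 2(2) ac_simps)
          moreover have "sqfree (insert v V - e) + c \<in> power_exps (insert v V) (insert {u, v} E) (Suc s)"
            using e 2(1) by auto
          ultimately show ?thesis by blast
        qed
      qed
    qed
  qed
qed

text \<open>
  An element \<open>a = h + q\<close> of the intersection has exponent at least \<open>s + 1\<close> at \<open>v\<close>, and so has \<open>q\<close>, as \<open>h\<close>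
  does not involve \<open>v\<close>. As \<open>q\<close> lies in the \<open>s\<close>-th power for the smaller tree, where the exponent at \<open>v\<close> is
  irrelevant, \<open>s + 1\<close> can be subtracted from it.
\<close>

lemma power_exps_leaf_Int:
  "(+) (single v (Suc s)) ` power_exps V E (Suc s) \<inter> (+) (sqfree (V - {u})) ` power_exps (insert v V) (insert {u, v} E) s =
     (+) (single v (Suc s) + sqfree (V - {u})) ` power_exps V E s" (is "?A \<inter> ?B = ?C")
proof
  show "?A \<inter> ?B \<subseteq> ?C"
  proof
    fix a assume "a \<in> ?A \<inter> ?B"
    then obtain p q where p: "a = single v (Suc s) + p" and q: "a = sqfree (V - {u}) + q"
        and "q \<in> power_exps (insert v V) (insert {u, v} E) s"
      by blast
    define c where "c = q - single v (Suc s)"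
    have "lookup q v = Suc s + lookup p v"
      using arg_cong[OF p, of "\<lambda>a. lookup a v"] v by (simp add: q lookup_add lookup_sqfree)
    then have "q = single v (Suc s) + c"
      by (intro poly_mapping_eqI) (auto simp: c_def lookup_add lookup_minus lookup_single when_def)
    then have "a = single v (Suc s) + sqfree (V - {u}) + c"
      by (simp add: q ac_simps)
    moreover have "c \<in> power_exps V E s"
      using v power_exps_leaf_subset[OF \<open>q \<in> power_exps (insert v V) (insert {u, v} E) s\<close>]
      by (rule power_exps_ignore) (simp add: c_def lookup_minus lookup_single)
    ultimately show "a \<in> ?C" by blast
  qed
  show "?C \<subseteq> ?A \<inter> ?B"
  proof clarify
    fix c assume c: "c \<in> power_exps V E s"
    obtain e0 where e0: "e0 \<in> E" "u \<in> e0"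
      using leaf_tree_incident[OF tree u] by blast
    have "sqfree (V - {u}) + c \<in> power_exps V E (Suc s)"
      using c e0(1) by (rule power_exps_sqfree_mono) (use e0 in auto)
    moreover have "single v s + c + single v 1 \<in> power_exps (insert v V) (insert {u, v} E) s"
      using power_exps_leaf_shift[OF c] by (rule power_exps_add)
    then have "single v (Suc s) + c \<in> power_exps (insert v V) (insert {u, v} E) s"
      by (simp add: ac_simps flip: single_add add.assoc)
    ultimately have "single v (Suc s) + (sqfree (V - {u}) + c) \<in> ?A"
        "sqfree (V - {u}) + (single v (Suc s) + c) \<in> ?B"
      by blast+
    then show "single v (Suc s) + sqfree (V - {u}) + c \<in> ?A \<inter> ?B"
      by (simp add: ac_simps del: power_exps.simps)
  qed
qed

end

text \<open>
  The ranks in the resolution of the \<open>s\<close>-th power for a tree with \<open>m + 2\<close> vertices. The recursion is the one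
  of \<open>linear_resolution_sum\<close>; a tree with two vertices has the unit ideal.
\<close>

fun power_rank :: "nat \<Rightarrow> nat \<Rightarrow> nat \<Rightarrow> nat" where
  "power_rank 0 s i = (if i = 0 then 1 else 0)"
| "power_rank (Suc m) 0 i = (if i = 0 then 1 else 0)"
| "power_rank (Suc m) (Suc s) i = power_rank m (Suc s) i + power_rank (Suc m) s i +
     (case i of 0 \<Rightarrow> 0 | Suc i' \<Rightarrow> power_rank m s i')"

text \<open>
  Induction over the leaves, and over \<open>s\<close> for each tree. For a tree with \<open>m + 3\<close> vertices, both summands of
  the \<open>(s + 1)\<close>-st power are generated in degree \<open>(m + 1) (s + 1)\<close>: the first in \<open>m (s + 1) + (s + 1)\<close>, the
  second in \<open>(m + 1) s + (m + 1)\<close>. Their intersection is generated in degree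
  \<open>m s + (s + 1) + (m + 1)\<close>, which is larger by one.
\<close>

lemma power_exps_linear_resolution:
  assumes "leaf_tree (V :: 'n::finite set) E"
  shows "linear_resolution (mono_ideal (power_exps V E s) :: ('n, 'k::field) mpoly set)
    (int ((card V - 2) * s)) (power_rank (card V - 2) s)"
  using assms
proof (induction arbitrary: s rule: leaf_tree.induct)
  case (edge u w)
  have "power_exps {u, w} {{u, w}} s = UNIV"
    by (induction s) simp_all
  moreover have "power_rank 0 s = (\<lambda>i. if i = 0 then 1 else 0)"
    by (rule ext) simp
  ultimately show ?case
    using edge linear_resolution_UNIV by (simp add: mono_ideal_UNIV)
next
  case (leaf V E u v)
  define m where "m = card V - 2"
  have m: "card V = Suc (Suc m)" "card (insert v V) - 2 = Suc m" "card (V - {u}) = Suc m"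
    using leaf_tree_card[OF leaf.hyps(1)] leaf.hyps by (simp_all add: m_def)
  have "linear_resolution (mono_ideal (power_exps (insert v V) (insert {u, v} E) s) :: ('n, 'k) mpoly set)
      (int (Suc m * s)) (power_rank (Suc m) s)"
  proof (induction s)
    case 0
    have "power_rank (Suc m) 0 = (\<lambda>i. if i = 0 then 1 else 0)"
      by (rule ext) simp
    then show ?case
      using linear_resolution_UNIV by (simp add: mono_ideal_UNIV)
  next
    case (Suc s)
    let ?A = "(+) (single v (Suc s)) ` power_exps V E (Suc s)"
    let ?B = "(+) (sqfree (V - {u})) ` power_exps (insert v V) (insert {u, v} E) s"
    let ?C = "(+) (single v (Suc s) + sqfree (V - {u})) ` power_exps V E s"
    have deg: "monom_degree (single v (Suc s)) = Suc s"
      by (simp add: monom_degree_def lookup_single when_def)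
    let ?d = "int (Suc m * Suc s)"
    have "linear_resolution (mono_ideal ?A :: ('n, 'k) mpoly set) ?d (power_rank m (Suc s))"
      using linear_resolution_monom_mult[OF leaf.IH[of "Suc s"], of "single v (Suc s)", folded mono_ideal_shift]
      by (simp add: deg m_def[symmetric] algebra_simps del: power_exps.simps)
    moreover have "linear_resolution (mono_ideal ?B :: ('n, 'k) mpoly set) ?d (power_rank (Suc m) s)"
      using linear_resolution_monom_mult[OF Suc.IH, of "sqfree (V - {u})", folded mono_ideal_shift]
      by (simp add: monom_degree_sqfree m algebra_simps)
    moreover have "linear_resolution (mono_ideal ?C :: ('n, 'k) mpoly set) (?d + 1) (power_rank m s)"
      using linear_resolution_monom_mult[OF leaf.IH[of s], of "single v (Suc s) + sqfree (V - {u})", folded mono_ideal_shift]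
      by (simp add: monom_degree_add deg monom_degree_sqfree m m_def[symmetric] algebra_simps)
    ultimately have "linear_resolution (mono_ideal (?A \<union> ?B) :: ('n, 'k) mpoly set) ?d
        (\<lambda>i. power_rank m (Suc s) i + power_rank (Suc m) s i + (case i of 0 \<Rightarrow> 0 | Suc i' \<Rightarrow> power_rank m s i'))"
      unfolding mono_ideal_Un power_exps_leaf_Int[OF leaf.hyps, of s, symmetric] mono_ideal_Int
      by (rule linear_resolution_sum)
    moreover have "(\<lambda>i. power_rank m (Suc s) i + power_rank (Suc m) s i +
        (case i of 0 \<Rightarrow> 0 | Suc i' \<Rightarrow> power_rank m s i')) = power_rank (Suc m) (Suc s)"
      by (rule ext) simp
    ultimately show ?case
      unfolding power_exps_leaf[OF leaf.hyps] by simp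
  qed
  then show ?case
    by (simp add: m)
qed

section \<open>Trees\<close>

lemma successively_nth: "successively P xs \<Longrightarrow> Suc k < length xs \<Longrightarrow> P (xs ! k) (xs ! Suc k)"
  by (induction P xs arbitrary: k rule: successively.induct) (auto simp: nth_Cons split: nat.split)

lemma leaf_tree_path:
  assumes "leaf_tree V E" and "x \<in> V" and "y \<in> V"
  obtains vs where "vs \<noteq> []" "hd vs = x" "last vs = y" "distinct vs" "set vs \<subseteq> V"
    "successively (\<lambda>a b. {a, b} \<in> E) vs"
proof -
  have "\<exists>vs. vs \<noteq> [] \<and> hd vs = x \<and> last vs = y \<and> distinct vs \<and> set vs \<subseteq> V \<and>
      successively (\<lambda>a b. {a, b} \<in> E) vs"
    using assms
  proof (induction arbitrary: x y rule: leaf_tree.induct)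
    case (edge u w)
    show ?case
    proof (cases "x = y")
      case True
      then show ?thesis
        using edge by (intro exI[of _ "[x]"]) auto
    next
      case False
      then show ?thesis
        using edge by (intro exI[of _ "[x, y]"]) auto
    qed
  next
    case (leaf V E u v)
    let ?S = "successively (\<lambda>a b. {a, b} \<in> insert {u, v} E)"
    have path: "\<exists>vs. vs \<noteq> [] \<and> hd vs = x \<and> last vs = y \<and> distinct vs \<and> set vs \<subseteq> V \<and> ?S vs"
      if "x \<in> V" "y \<in> V" for x y
    proof -
      obtain vs where vs: "vs \<noteq> []" "hd vs = x" "last vs = y" "distinct vs" "set vs \<subseteq> V"
          "successively (\<lambda>a b. {a, b} \<in> E) vs"
        using leaf.IH[OF \<open>x \<in> V\<close> \<open>y \<in> V\<close>] by blast
      have "?S vs"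
        using vs(6) by (rule successively_mono) auto
      with vs show ?thesis by blast
    qed
    consider "x \<in> V" "y \<in> V" | "x = v" "y = v" | "x = v" "y \<in> V" | "x \<in> V" "y = v"
      using leaf.prems by auto
    then show ?case
    proof cases
      case 1
      then show ?thesis using path by (meson subset_insertI2)
    next
      case 2
      then show ?thesis by (intro exI[of _ "[v]"]) auto
    next
      case 3
      obtain vs where "vs \<noteq> []" "hd vs = u" "last vs = y" "distinct vs" "set vs \<subseteq> V" "?S vs"
        using path[OF leaf.hyps(2) 3(2)] by blast
      then show ?thesis
        using 3 leaf.hyps(3) by (intro exI[of _ "v # vs"]) (auto simp: successively_Cons insert_commute)
    next
      case 4
      obtain vs where "vs \<noteq> []" "hd vs = x" "last vs = u" "distinct vs" "set vs \<subseteq> V" "?S vs"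
        using path[OF 4(1) leaf.hyps(2)] by blast
      then show ?thesis
        using 4 leaf.hyps(3) by (intro exI[of _ "vs @ [v]"]) (auto simp: successively_append_iff)
    qed
  qed
  then show thesis using that by blast
qed

lemma rtrancl_crossing:
  assumes "(u, v) \<in> R\<^sup>*" and "u \<in> V" and "v \<notin> V"
  shows "\<exists>x y. (x, y) \<in> R \<and> x \<in> V \<and> y \<notin> V"
  using assms by (induction rule: rtrancl_induct) auto

text \<open>
  As long as a subtree misses a vertex, connectedness provides an edge that leaves it and can be added.
\<close>

lemma leaf_tree_grow:
  fixes T :: "'n::finite graph"
  assumes "connected_graph T" and "leaf_tree V E" and "E \<subseteq> T"
  shows "\<exists>E'\<subseteq>T. leaf_tree UNIV E'"
  using assms(2,3)
proof (induction "card (- V)" arbitrary: V E rule: less_induct)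
  case less
  show ?case
  proof (cases "V = UNIV")
    case True
    then show ?thesis using less.prems by blast
  next
    case False
    then obtain b where b: "b \<notin> V" by blast
    obtain a where a: "a \<in> V"
      using leaf_tree_card[OF less.prems(1)] by fastforce
    have "(a, b) \<in> {(x, y). {x, y} \<in> T}\<^sup>*"
      using assms(1) by (simp add: connected_graph_def)
    from rtrancl_crossing[OF this a b] obtain u v where uv: "{u, v} \<in> T" "u \<in> V" "v \<notin> V"
      by auto
    have "card (- insert v V) < card (- V)"
      using uv(3) by (intro psubset_card_mono) auto
    moreover have "leaf_tree (insert v V) (insert {u, v} E)"
      using less.prems(1) uv(2,3) by (rule leaf_tree.leaf)
    moreover have "insert {u, v} E \<subseteq> T"
      using uv(1) less.prems(2) by blast
    ultimately show ?thesis
      by (rule less.hyps)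
  qed
qed

text \<open>
  A subtree grown to all vertices already contains all edges: any further edge would close a cycle with the
  path that joins its ends in the subtree.
\<close>

lemma tree_graph_leaf_tree:
  fixes T :: "'n::finite graph"
  assumes T: "tree_graph T" and n: "card (UNIV :: 'n set) \<ge> 2"
  shows "leaf_tree UNIV T"
proof -
  have simple: "\<And>e. e \<in> T \<Longrightarrow> card e = 2" and conn: "connected_graph T"
      and acyclic: "\<And>vs. \<not> cycle_in T vs"
    using T by (auto simp: tree_graph_def simple_graph_def)
  have "\<not> (UNIV :: 'n set) \<subseteq> {a}" for a
    using n card_mono[of "{a}" "UNIV :: 'n set"] by auto
  then obtain a b :: 'n where "a \<noteq> b"
    by blast
  then have "\<exists>x y. (x, y) \<in> {(x, y). {x, y} \<in> T} \<and> x \<in> {a} \<and> y \<notin> {a}"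
    using conn by (intro rtrancl_crossing[of a b]) (auto simp: connected_graph_def)
  then obtain y where "{a, y} \<in> T" "y \<noteq> a"
    by auto
  then obtain E where E: "E \<subseteq> T" "leaf_tree UNIV E"
    using leaf_tree_grow[OF conn leaf_tree.edge[of a y]] by auto
  have "e \<in> E" if "e \<in> T" for e
  proof (rule ccontr)
    assume "e \<notin> E"
    obtain x y where e: "e = {x, y}" "x \<noteq> y"
      using simple[OF \<open>e \<in> T\<close>] by (auto simp: card_2_iff)
    obtain vs where vs: "vs \<noteq> []" "hd vs = x" "last vs = y" "distinct vs"
        "successively (\<lambda>a b. {a, b} \<in> E) vs"
      using leaf_tree_path[OF E(2) UNIV_I UNIV_I] by blast
    have "length vs \<noteq> 1"
      using vs(2,3) e(2) by (auto simp: length_Suc_conv)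
    moreover have "length vs \<noteq> 2"
      using vs(2,3,5) e(1) \<open>e \<notin> E\<close> by (auto simp: numeral_2_eq_2 length_Suc_conv)
    moreover have "length vs \<noteq> 0"
      using vs(1) by simp
    ultimately have len: "3 \<le> length vs"
      by linarith
    have "{vs ! k, vs ! (Suc k mod length vs)} \<in> T" if "k < length vs" for k
    proof (cases "Suc k < length vs")
      case True
      then show ?thesis
        using successively_nth[OF vs(5) True] E(1) by auto
    next
      case False
      then have "k = length vs - 1"
        using that by simp
      then have "vs ! k = y" "vs ! (Suc k mod length vs) = x"
        using vs(1-3) by (simp_all add: last_conv_nth hd_conv_nth)
      then show ?thesis
        using \<open>e \<in> T\<close> e(1) by (simp add: insert_commute)
    qed
    then have "cycle_in T vs"
      using len vs(4) by (simp add: cycle_in_def)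
    then show False
      using acyclic by blast
  qed
  then have "E = T"
    using E(1) by blast
  then show ?thesis
    using E(2) by simp
qed

section \<open>Cover ideals of complements of trees\<close>

lemma cover_set_complement:
  "cover_set (complement_graph T) C \<longleftrightarrow> (\<forall>i j. i \<notin> C \<longrightarrow> j \<notin> C \<longrightarrow> i \<noteq> j \<longrightarrow> {i, j} \<in> T)"
  by (auto simp: cover_set_def complement_graph_def)

lemma tree_no_triangle:
  assumes "tree_graph T" and "{x, y} \<in> T" "{y, z} \<in> T" "{z, x} \<in> T" and "x \<noteq> y" "y \<noteq> z" "z \<noteq> x"
  shows False
proof -
  have "{[x, y, z] ! k, [x, y, z] ! (Suc k mod 3)} \<in> T" if "k < 3" for k
  proof -
    have "k = 0 \<or> k = 1 \<or> k = 2"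
      using that by arith
    then show ?thesis
      using assms(2-4) by auto
  qed
  then have "cycle_in T [x, y, z]"
    using assms(5-7) by (simp add: cycle_in_def)
  then show False
    using assms(1) by (auto simp: tree_graph_def)
qed

text \<open>
  The complement of a cover set of the complement graph is a clique of \<open>T\<close>. Without triangles a clique has at
  most two vertices, and as every vertex lies on an edge, every clique is contained in an edge.
\<close>

lemma minimal_cover_complement_tree:
  fixes T :: "'n::finite graph"
  assumes T: "tree_graph T" and L: "leaf_tree UNIV T"
  shows "minimal_cover_set (complement_graph T) C \<longleftrightarrow> (\<exists>e\<in>T. C = UNIV - e)"
proof
  have edge: "\<exists>x y. e = {x, y} \<and> x \<noteq> y" if "e \<in> T" for e
    using T that by (auto simp: tree_graph_def simple_graph_def card_2_iff)
  have cover: "cover_set (complement_graph T) (UNIV - e)" if "e \<in> T" for e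
    unfolding cover_set_complement
  proof (intro allI impI)
    fix i j assume "i \<notin> UNIV - e" "j \<notin> UNIV - e" "i \<noteq> j"
    then have "{i, j} = e"
      using edge[OF that] by auto
    then show "{i, j} \<in> T"
      using that by simp
  qed
  show "minimal_cover_set (complement_graph T) C" if "\<exists>e\<in>T. C = UNIV - e"
  proof -
    obtain e where e: "e \<in> T" "C = UNIV - e"
      using \<open>\<exists>e\<in>T. C = UNIV - e\<close> by blast
    obtain x y where xy: "e = {x, y}" "x \<noteq> y"
      using edge[OF e(1)] by blast
    have "\<not> cover_set (complement_graph T) (C - {l})" if "l \<in> C" for l
    proof
      assume "cover_set (complement_graph T) (C - {l})"
      then have "{x, y} \<in> T" "{y, l} \<in> T" "{l, x} \<in> T"
        using that xy e by (auto simp: cover_set_complement)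
      moreover have "y \<noteq> l" "l \<noteq> x"
        using that e xy by auto
      ultimately show False
        using tree_no_triangle[OF T] xy(2) by blast
    qed
    then show ?thesis
      using cover e by (simp add: minimal_cover_set_def)
  qed
  show "\<exists>e\<in>T. C = UNIV - e" if "minimal_cover_set (complement_graph T) C"
  proof -
    have clique: "{i, j} \<in> T" if "i \<notin> C" "j \<notin> C" "i \<noteq> j" for i j
      using \<open>minimal_cover_set _ C\<close> that by (auto simp: minimal_cover_set_def cover_set_complement)
    have "\<exists>e\<in>T. - C \<subseteq> e"
    proof (cases "\<exists>x y. x \<notin> C \<and> y \<notin> C \<and> x \<noteq> y")
      case True
      then obtain x y where xy: "x \<notin> C" "y \<notin> C" "x \<noteq> y"
        by blast
      have "z = x \<or> z = y" if "z \<notin> C" for z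
        using tree_no_triangle[OF T clique clique clique, of x y z] xy that by blast
      then have "- C \<subseteq> {x, y}"
        by blast
      then show ?thesis
        using clique[OF xy] by blast
    next
      case False
      obtain x where "- C \<subseteq> {x}"
        using False by blast
      then show ?thesis
        using leaf_tree_incident[OF L UNIV_I, of x] by blast
    qed
    then obtain e where e: "e \<in> T" "- C \<subseteq> e"
      by blast
    have "l \<notin> e" if "l \<in> C" for l
    proof
      assume "l \<in> e"
      then have "UNIV - e \<subseteq> C - {l}"
        using e(2) by blast
      then have "cover_set (complement_graph T) (C - {l})"
        using cover[OF e(1)] unfolding cover_set_def by blast
      then show False
        using \<open>minimal_cover_set _ C\<close> that by (simp add: minimal_cover_set_def)
    qed
    then show ?thesis
      using e by blast
  qed
qed

lemma prod_X: "(\<Prod>i\<in>C. X i) = single (sqfree C) 1"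
proof (induction C rule: infinite_finite_induct)
  case (insert i C)
  have "sqfree (insert i C) = single i 1 + sqfree C"
    using insert by (simp add: sqfree_def)
  then show ?case
    using insert by (simp add: X_def mult_single)
qed (simp_all add: single_one)

lemma cover_ideal_complement_tree:
  fixes T :: "'n::finite graph"
  assumes "tree_graph T" and "leaf_tree UNIV T"
  shows "(cover_ideal (complement_graph T) :: ('n, 'k::field) mpoly set) =
    mono_ideal {sqfree (UNIV - e) + b | e b. e \<in> T}"
proof -
  have "{\<Prod>i\<in>C. X i :: ('n, 'k) mpoly | C. minimal_cover_set (complement_graph T) C} =
      (\<lambda>m. single m 1) ` (\<lambda>e. sqfree (UNIV - e)) ` T"
    by (auto simp: prod_X minimal_cover_complement_tree[OF assms])
  then have "(cover_ideal (complement_graph T) :: ('n, 'k) mpoly set) =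
      mono_ideal {m + b | m b. m \<in> (\<lambda>e. sqfree (UNIV - e)) ` T}"
    unfolding cover_ideal_def by (simp only: ideal_gen_monomials)
  also have "{m + b | m b. m \<in> (\<lambda>e. sqfree (UNIV - e)) ` T} = {sqfree (UNIV - e) + b | e b. e \<in> T}"
    by blast
  finally show ?thesis .
qed

lemma cover_ideal_power:
  fixes T :: "'n::finite graph"
  assumes "tree_graph T" and "leaf_tree UNIV T"
  shows "(ideal_power (cover_ideal (complement_graph T)) s :: ('n, 'k::field) mpoly set) =
    mono_ideal (power_exps UNIV T s)"
proof (induction s)
  case 0
  show ?case by (simp add: mono_ideal_UNIV)
next
  case (Suc s)
  have "{u + v | u v. u \<in> {sqfree (UNIV - e) + b | e b. e \<in> T} \<and> v \<in> power_exps UNIV T s} =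
      power_exps UNIV T (Suc s)" (is "?L = ?R")
  proof
    show "?L \<subseteq> ?R"
    proof clarify
      fix e b v assume e: "e \<in> T" and v: "v \<in> power_exps UNIV T s"
      have "b + v \<in> power_exps UNIV T s"
        using power_exps_add[OF v, of b] by (simp add: add.commute)
      then show "sqfree (UNIV - e) + b + v \<in> power_exps UNIV T (Suc s)"
        using e by (auto simp: add.assoc)
    qed
    show "?R \<subseteq> ?L"
      by (auto simp del: add_0_right) (metis add_0_right)
  qed
  then show ?case
    unfolding ideal_power.simps Suc.IH
    unfolding cover_ideal_complement_tree[OF assms] ideal_mult_mono_ideal[OF up_closed_power_exps]
    by simp
qed

text \<open>
  A tree with a single vertex has no edges, so both ideals coincide in this case, which the induction over
  leaves does not reach.
\<close>

theorem corollary3p12: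
  fixes T1 T2 :: "'n::finite graph"
    and J1 J2 :: "('n, 'k::field) mpoly set"
  assumes "tree_graph T1" and "tree_graph T2"
    and "J1 = cover_ideal (complement_graph T1)"
    and "J2 = cover_ideal (complement_graph T2)"
  shows "\<forall>s\<ge>1. \<forall>i j. betti (ideal_power J1 s) i j = betti (ideal_power J2 s) i j"
proof (cases "card (UNIV :: 'n set) \<ge> 2")
  case True
  have "linear_resolution (ideal_power (cover_ideal (complement_graph T)) s :: ('n, 'k) mpoly set)
      (int ((card (UNIV :: 'n set) - 2) * s)) (power_rank (card (UNIV :: 'n set) - 2) s)" if "tree_graph T" for T s
    unfolding cover_ideal_power[OF that tree_graph_leaf_tree[OF that True]]
    by (rule power_exps_linear_resolution[OF tree_graph_leaf_tree[OF that True]])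
  then show ?thesis
    using assms by (blast intro: betti_linear_resolution)
next
  case False
  have "T = {}" if "tree_graph T" for T :: "'n graph"
  proof -
    have "card e \<noteq> 2" for e :: "'n set"
      using card_mono[of UNIV e] False by auto
    then show ?thesis
      using that by (auto simp: tree_graph_def simple_graph_def)
  qed
  then have "T1 = T2"
    using assms(1,2) by blast
  then show ?thesis
    using assms(3,4) by simp
qed

end
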